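(* Let $n\ge1$ and suppose $\alpha,\lambda,\sigma$ are constants with $\alpha\in(0,n+2)$, $\lambda\ge\frac{n+2}{n}$, $\sigma\ge0$, and $\sigma>1+\frac{2-\alpha}{n+2}\lambda$. Let $\varphi:(0,1)\to(0,\infty)$ be continuous with $\lim_{t\to0^+}\varphi(t)=\infty$. Then there exists a positive function $u\in C^\infty(\mathbb{R}^n\times(0,1))\cap L^\lambda(\mathbb{R}^n\times(0,1))$ satisfying $$0\le u_t-\Delta u\le \Big(\iint_{\mathbb{R}^n\times(0,1)}\Phi(x-y,t-s)^{\alpha/n}u(y,s)^\lambda\,dy\,ds\Big)\,u(x,t)^\sigma\quad\text{in }\mathbb{R}^n\times(0,1)$$ such that $u(0,t)\ne O(\varphi(t))$ as $t\to0^+$.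
   Context: $\Phi$ is the heat kernel: $\Phi(x,t)=(4\pi t)^{-n/2}e^{-|x|^2/(4t)}$ for $t>0$ and $\Phi(x,t)=0$ for $t\le0$. *)

theory Defs
  imports "HOL-Analysis.Analysis" "HOL-Library.Landau_Symbols"
begin

definition heat_kernel :: "'a::euclidean_space \<Rightarrow> real \<Rightarrow> real" where
  "heat_kernel x t = (if t > 0
     then (4 * pi * t) powr (- real DIM('a) / 2) * exp (- (norm x)\<^sup>2 / (4 * t))
     else 0)"

fun Ck_on :: "nat \<Rightarrow> 'v::euclidean_space set \<Rightarrow> ('v \<Rightarrow> real) \<Rightarrow> bool" where
  "Ck_on 0 S f = continuous_on S f"
| "Ck_on (Suc k) S f = (continuous_on S f \<and> (\<forall>x\<in>S. f differentiable (at x)) \<and>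
      (\<forall>i\<in>Basis. Ck_on k S (\<lambda>x. frechet_derivative f (at x) i)))"

definition smooth_on :: "'v::euclidean_space set \<Rightarrow> ('v \<Rightarrow> real) \<Rightarrow> bool" where
  "smooth_on S f \<longleftrightarrow> (\<forall>k. Ck_on k S f)"

definition time_deriv :: "('a::euclidean_space \<times> real \<Rightarrow> real) \<Rightarrow> 'a \<times> real \<Rightarrow> real" where
  "time_deriv u p = frechet_derivative u (at p) (0, 1)"

definition space_laplacian :: "('a::euclidean_space \<times> real \<Rightarrow> real) \<Rightarrow> 'a \<times> real \<Rightarrow> real" where
  "space_laplacian u p = (\<Sum>i\<in>Basis.
      frechet_derivative (\<lambda>q. frechet_derivative u (at q) (i, 0)) (at p) (i, 0))"

end

theory Submission
  imports Defs "HOL-Probability.Distributions" "HOL-Real_Asymp.Real_Asymp"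
begin

text \<open>
  The solution is a sum of switched-on heat kernels
  \<open>v\<^sub>i(x,t) = r\<^sub>i\<^bsup>n-2p\<^esup> \<chi>((t - s\<^sub>i) / r\<^sub>i\<^sup>2) \<Phi>(x, t - s\<^sub>i + r\<^sub>i\<^sup>2)\<close> with geometric radii \<open>r\<^sub>i = R\<^sup>-\<^sup>i\<^sup>-\<^sup>N\<close>, where \<open>\<chi>\<close>
  is a smooth step from 0 to 1. Its heat operator is the nonnegative source
  \<open>r\<^sub>i\<^bsup>n-2p-2\<^esup> \<chi>' \<Phi>\<close>, which lives only on \<open>s\<^sub>i < t < s\<^sub>i + r\<^sub>i\<^sup>2\<close>. Writing \<open>r\<close> for the radius of the preceding
  pulse, at that time the preceding pulse makes \<open>u\<close> of size \<open>r\<^bsup>-2p\<^esup>\<close> and the integral of size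
  \<open>r\<^bsup>n+2-\<alpha>-2p\<lambda>\<^esup>\<close> at scale \<open>r\<close>, so the upper bound holds for small radii as soon as
  \<open>2p(\<lambda> + \<sigma> - 1) > n + 4 - \<alpha>\<close>; the ratio \<open>R\<close> is taken so large that the Gaussian tail of the source is dominated by the
  wider tails of \<open>u\<close> and of the integral. Membership in \<open>L\<^sup>\<lambda>\<close> needs \<open>2p\<lambda> < n + 2\<close>, and the hypothesis on
  \<open>\<sigma>\<close> says precisely that both conditions on \<open>p\<close> are compatible. A chain of pulses is
  continued until its amplitude beats \<open>\<phi>\<close>, which happens after finitely many steps because the
  switching times stay in a compact subset of \<open>(0,1)\<close>; then a new chain, starting from the initial
  data, is run at an earlier time.
\<close>

section \<open>Calculus of \<open>Ck_on\<close>\<close>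

lemma frechet_derivative_cong_open:
  fixes f g :: "'v::euclidean_space \<Rightarrow> real"
  assumes "open S" "x \<in> S" "\<And>y. y \<in> S \<Longrightarrow> f y = g y"
  shows "frechet_derivative f (at x) = frechet_derivative g (at x)"
    and "f differentiable (at x) \<longleftrightarrow> g differentiable (at x)"
proof -
  have *: "(f has_derivative D) (at x) \<longleftrightarrow> (g has_derivative D) (at x)" for D
    using assms has_derivative_transform_within_open[of f D x UNIV S g]
      has_derivative_transform_within_open[of g D x UNIV S f] by auto
  show "frechet_derivative f (at x) = frechet_derivative g (at x)"
    unfolding frechet_derivative_def * ..
  show "f differentiable (at x) \<longleftrightarrow> g differentiable (at x)"
    unfolding differentiable_def * ..
qed

text \<open>Openness turns agreement on the set into agreement near each point, so the derivatives
  agree too and the induction reaches every order.\<close>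

lemma Ck_on_cong:
  assumes "open S" "\<And>y. y \<in> S \<Longrightarrow> f y = g y"
  shows "Ck_on k S f \<longleftrightarrow> Ck_on k S g"
  using assms(2)
proof (induction k arbitrary: f g)
  case 0
  then show ?case by (simp cong: continuous_on_cong)
next
  case (Suc k)
  have "continuous_on S f \<longleftrightarrow> continuous_on S g"
    using Suc.prems by (simp cong: continuous_on_cong)
  moreover have "Ck_on k S (\<lambda>x. frechet_derivative f (at x) i)
      \<longleftrightarrow> Ck_on k S (\<lambda>x. frechet_derivative g (at x) i)" for i
    using frechet_derivative_cong_open(1)[OF assms(1), of _ f g] Suc.prems
    by (intro Suc.IH) auto
  ultimately show ?case
    using frechet_derivative_cong_open(2)[OF assms(1), of _ f g] Suc.prems by auto
qed

lemma Ck_on_eqI: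
  assumes "open S" "Ck_on k S g" "\<And>y. y \<in> S \<Longrightarrow> f y = g y"
  shows "Ck_on k S f"
  using Ck_on_cong[of S f g k] assms by simp

lemma Ck_on_lower: "Ck_on (Suc k) S f \<Longrightarrow> Ck_on k S f"
  by (induction k arbitrary: f) auto

lemma Ck_on_subset: "Ck_on k S f \<Longrightarrow> T \<subseteq> S \<Longrightarrow> Ck_on k T f"
  by (induction k arbitrary: f) (auto intro: continuous_on_subset)

text \<open>Smoothness is local. This glues the two half-spaces on which a pulse is understood, and
  the cylinders on which the series for \<open>u\<close> converges uniformly with its
  derivatives.\<close>

lemma Ck_on_Union:
  assumes "\<And>T. T \<in> \<T> \<Longrightarrow> open T" "\<And>T. T \<in> \<T> \<Longrightarrow> Ck_on k T f"
  shows "Ck_on k (\<Union>\<T>) f"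
  using assms(2)
proof (induction k arbitrary: f)
  case 0
  then show ?case
    using continuous_on_open_UN[of \<T> "\<lambda>T. T" f] assms(1) by auto
next
  case (Suc k)
  have "continuous_on (\<Union>\<T>) f"
    using continuous_on_open_UN[of \<T> "\<lambda>T. T" f] assms(1) Suc.prems by auto
  moreover have "Ck_on k (\<Union>\<T>) (\<lambda>x. frechet_derivative f (at x) i)" if "i \<in> Basis" for i
    using Suc.prems that by (intro Suc.IH) auto
  ultimately show ?case using Suc.prems by auto
qed

lemma Ck_on_const: "Ck_on k S (\<lambda>x. c)"
  by (induction k arbitrary: c) auto

lemma Ck_on_bounded_linear:
  assumes "bounded_linear f"
  shows "Ck_on k S f"
proof (cases k)
  case (Suc m)
  have d: "(f has_derivative f) (at x)" for x
    using assms by (rule bounded_linear_imp_has_derivative)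
  have "frechet_derivative f (at x) = f" for x
    using frechet_derivative_at[OF d] by simp
  then show ?thesis
    using assms d Ck_on_const Suc
    by (auto simp: differentiable_def linear_continuous_on)
qed (use assms in \<open>simp add: linear_continuous_on\<close>)

lemma Ck_on_add:
  assumes "open S" "Ck_on k S f" "Ck_on k S g"
  shows "Ck_on k S (\<lambda>x. f x + g x)"
  using assms(2,3)
proof (induction k arbitrary: f g)
  case 0
  then show ?case by (simp add: continuous_on_add)
next
  case (Suc k)
  have eq: "frechet_derivative (\<lambda>x. f x + g x) (at x) i
      = frechet_derivative f (at x) i + frechet_derivative g (at x) i" if "x \<in> S" for x i
  proof -
    have "((\<lambda>x. f x + g x) has_derivative
        (\<lambda>h. frechet_derivative f (at x) h + frechet_derivative g (at x) h)) (at x)"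
      using Suc.prems that by (intro has_derivative_add) (auto simp flip: frechet_derivative_works)
    from frechet_derivative_at[OF this] show ?thesis by metis
  qed
  have "Ck_on k S (\<lambda>x. frechet_derivative (\<lambda>x. f x + g x) (at x) i)" if "i \<in> Basis" for i
  proof (rule Ck_on_eqI[OF assms(1) _ eq])
    show "Ck_on k S (\<lambda>x. frechet_derivative f (at x) i + frechet_derivative g (at x) i)"
      using Suc.prems that by (intro Suc.IH) auto
  qed
  moreover have "continuous_on S (\<lambda>x. f x + g x)"
    using Suc.prems by (simp add: continuous_on_add)
  moreover have "(\<lambda>x. f x + g x) differentiable (at x)" if "x \<in> S" for x
    using Suc.prems that by (simp add: differentiable_add)
  ultimately show ?case by simp
qed

lemma Ck_on_mult:
  assumes "open S" "Ck_on k S f" "Ck_on k S g"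
  shows "Ck_on k S (\<lambda>x. f x * g x)"
  using assms(2,3)
proof (induction k arbitrary: f g)
  case 0
  then show ?case by (simp add: continuous_on_mult)
next
  case (Suc k)
  have eq: "frechet_derivative (\<lambda>x. f x * g x) (at x) i
      = f x * frechet_derivative g (at x) i + frechet_derivative f (at x) i * g x" if "x \<in> S" for x i
  proof -
    have "((\<lambda>x. f x * g x) has_derivative
        (\<lambda>h. f x * frechet_derivative g (at x) h + frechet_derivative f (at x) h * g x)) (at x)"
      using Suc.prems that by (intro has_derivative_mult) (auto simp flip: frechet_derivative_works)
    from frechet_derivative_at[OF this] show ?thesis by metis
  qed
  have "Ck_on k S (\<lambda>x. frechet_derivative (\<lambda>x. f x * g x) (at x) i)" if i: "i \<in> Basis" for i
  proof -
    have "Ck_on k S f" "Ck_on k S g"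
      using Suc.prems Ck_on_lower by blast+
    then have "Ck_on k S (\<lambda>x. f x * frechet_derivative g (at x) i + frechet_derivative f (at x) i * g x)"
      using Suc.prems i by (intro Ck_on_add assms(1) Suc.IH) auto
    then show ?thesis
      by (rule Ck_on_eqI[OF assms(1)]) (rule eq)
  qed
  then show ?case using Suc.prems by (auto intro: continuous_on_mult)
qed

lemma Ck_on_sum:
  assumes "open S" "\<And>i. i \<in> I \<Longrightarrow> Ck_on k S (f i)"
  shows "Ck_on k S (\<lambda>x. \<Sum>i\<in>I. f i x)"
  using assms(2)
  by (induction I rule: infinite_finite_induct) (auto simp: Ck_on_const intro!: Ck_on_add assms(1))

text \<open>\<open>G m\<close> is the \<open>m\<close>-th derivative of the outer function.\<close>
lemma Ck_on_compose_real:
  fixes G :: "nat \<Rightarrow> real \<Rightarrow> real"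
  assumes "open S" "\<And>x. x \<in> S \<Longrightarrow> f x \<in> T"
    and G: "\<And>m y. y \<in> T \<Longrightarrow> (G m has_real_derivative G (Suc m) y) (at y)"
    and "Ck_on k S f"
  shows "Ck_on k S (\<lambda>x. G m (f x))"
  using assms(4)
proof (induction k arbitrary: m)
  case 0
  have "continuous_on T (G m)"
    using G DERIV_isCont continuous_at_imp_continuous_on by blast
  then show ?case
    using 0 assms(2) by (auto intro!: continuous_on_compose2[of T "G m"])
next
  case (Suc k)
  have d: "((\<lambda>x. G m (f x)) has_derivative (\<lambda>h. frechet_derivative f (at x) h * G (Suc m) (f x))) (at x)"
    if "x \<in> S" for x
    using Suc.prems that assms(2)
    by (intro has_derivative_compose[OF _ G[unfolded has_field_derivative_def], THEN has_derivative_eq_rhs])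
      (auto simp: ac_simps simp flip: frechet_derivative_works)
  have "Ck_on k S (\<lambda>x. frechet_derivative (\<lambda>x. G m (f x)) (at x) i)" if i: "i \<in> Basis" for i
  proof -
    have "Ck_on k S (\<lambda>x. frechet_derivative f (at x) i * G (Suc m) (f x))"
      using Suc.prems i Ck_on_lower[OF Suc.prems]
      by (intro Ck_on_mult assms(1) Suc.IH) auto
    then show ?thesis
      by (rule Ck_on_eqI[OF assms(1)]) (simp flip: frechet_derivative_at[OF d])
  qed
  moreover have "continuous_on S (\<lambda>x. G m (f x))"
    using d by (meson continuous_at_imp_continuous_on has_derivative_continuous)
  ultimately show ?case using d by (auto simp: differentiable_def)
qed

section \<open>Termwise differentiation of series\<close>

text \<open>The head of the list is differentiated first. Bounds assumed for all lists therefore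
  pass to a partial derivative by prepending its direction, which drives the inductions on series
  below.\<close>

fun iter_deriv :: "'v::euclidean_space list \<Rightarrow> ('v \<Rightarrow> real) \<Rightarrow> 'v \<Rightarrow> real" where
  "iter_deriv [] f = f"
| "iter_deriv (b # bs) f = iter_deriv bs (\<lambda>x. frechet_derivative f (at x) b)"

lemma smooth_onD:
  assumes "smooth_on S f"
  shows "continuous_on S f" "\<And>x. x \<in> S \<Longrightarrow> f differentiable (at x)"
    "\<And>b. b \<in> Basis \<Longrightarrow> smooth_on S (\<lambda>x. frechet_derivative f (at x) b)"
  using assms Ck_on.simps(2) unfolding smooth_on_def by (metis, metis, metis)

lemma smooth_on_iter_deriv:
  "smooth_on S f \<Longrightarrow> set l \<subseteq> Basis \<Longrightarrow> smooth_on S (iter_deriv l f)"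
  by (induction l arbitrary: f) (auto intro: smooth_onD)

lemma iter_deriv_cong:
  assumes "open S" "\<And>y. y \<in> S \<Longrightarrow> f y = g y" "x \<in> S"
  shows "iter_deriv l f x = iter_deriv l g x"
  using assms(2)
proof (induction l arbitrary: f g)
  case (Cons b l)
  have "frechet_derivative f (at y) b = frechet_derivative g (at y) b" if "y \<in> S" for y
    using frechet_derivative_cong_open(1)[OF assms(1) that Cons.prems] by simp
  then show ?case
    unfolding iter_deriv.simps by (rule Cons.IH)
qed (use assms(3) in auto)

text \<open>Late pulses are multiples of translates of one heat kernel, so this reduces their
  derivatives to those of a single function.\<close>

lemma iter_deriv_shift:
  assumes "open S" "smooth_on S f" "set l \<subseteq> Basis" "x + c \<in> S"
  shows "iter_deriv l (\<lambda>y. a * f (y + c)) x = a * iter_deriv l f (x + c)"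
  using assms(2,3)
proof (induction l arbitrary: f)
  case (Cons b l)
  let ?T = "(\<lambda>y. y + c) -` S"
  have "open ?T"
    by (rule open_vimage[OF assms(1)]) (intro continuous_intros)
  have "frechet_derivative (\<lambda>y. a * f (y + c)) (at y) b = a * frechet_derivative f (at (y + c)) b"
    if "y \<in> ?T" for y
  proof -
    have "(f has_derivative frechet_derivative f (at (y + c))) (at (y + c))"
      using smooth_onD(2)[OF Cons.prems(1)] that by (auto simp flip: frechet_derivative_works)
    moreover have "((\<lambda>y. y + c) has_derivative (\<lambda>h. h)) (at y)"
      by (auto intro!: derivative_eq_intros)
    ultimately have "((\<lambda>y. f (y + c)) has_derivative (\<lambda>h. frechet_derivative f (at (y + c)) h)) (at y)"
      using has_derivative_compose by blast
    from frechet_derivative_at[OF has_derivative_mult_right[OF this, of a]]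
    show ?thesis by metis
  qed
  then have "iter_deriv l (\<lambda>y. frechet_derivative (\<lambda>y. a * f (y + c)) (at y) b) x
     = iter_deriv l (\<lambda>y. a * frechet_derivative f (at (y + c)) b) x"
    using assms(4) by (intro iter_deriv_cong[OF \<open>open ?T\<close>]) auto
  also have "\<dots> = a * iter_deriv l (\<lambda>y. frechet_derivative f (at y) b) (x + c)"
    using Cons.prems by (intro Cons.IH) (auto intro: smooth_onD)
  finally show ?case by simp
qed auto

text \<open>Only the partial derivatives are majorised. The Weierstrass test makes each of their
  series uniformly convergent, and linearity recombines them into a total derivative that converges
  uniformly in operator norm, as termwise differentiation requires.\<close>

lemma has_derivative_suminf_partials:
  fixes f :: "nat \<Rightarrow> 'v::euclidean_space \<Rightarrow> real"
  assumes "open S" "convex S" "x \<in> S"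
    and diff: "\<And>n x. x \<in> S \<Longrightarrow> f n differentiable (at x)"
    and sm: "\<And>x. x \<in> S \<Longrightarrow> summable (\<lambda>n. f n x)"
    and bd: "\<And>b. b \<in> Basis \<Longrightarrow> \<exists>M. summable M \<and>
        (\<forall>\<^sub>F n in sequentially. \<forall>x\<in>S. \<bar>frechet_derivative (f n) (at x) b\<bar> \<le> M n)"
  shows "((\<lambda>x. \<Sum>n. f n x) has_derivative
     (\<lambda>h. \<Sum>b\<in>Basis. (h \<bullet> b) * (\<Sum>n. frechet_derivative (f n) (at x) b))) (at x)"
proof -
  define D where "D n x b = frechet_derivative (f n) (at x) b" for n x b
  define g' where "g' x h = (\<Sum>b\<in>Basis. (h \<bullet> b) * (\<Sum>n. D n x b))" for x h
  have lin: "D n x h = (\<Sum>b\<in>Basis. (h \<bullet> b) * D n x b)" if "x \<in> S" for n x h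
  proof -
    have "linear (D n x)"
      using diff that linear_frechet_derivative unfolding D_def by blast
    then have "D n x (\<Sum>b\<in>Basis. (h \<bullet> b) *\<^sub>R b) = (\<Sum>b\<in>Basis. (h \<bullet> b) * D n x b)"
      by (simp add: linear_sum linear_cmul)
    then show ?thesis by (simp add: euclidean_representation)
  qed
  have unif: "uniform_limit S (\<lambda>n x. \<Sum>i<n. D i x b) (\<lambda>x. \<Sum>i. D i x b) sequentially"
    if "b \<in> Basis" for b
    using bd[OF that] Weierstrass_m_test_ev[of S "\<lambda>n x. D n x b"] by (auto simp: D_def)
  have main: "\<forall>\<^sub>F n in sequentially. \<forall>x\<in>S. \<forall>h. norm ((\<Sum>i<n. D i x h) - g' x h) \<le> e * norm h"
    if "e > 0" for e
  proof -
    \<comment> \<open>There are \<open>DIM('v)\<close> coordinate errors, each at most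
      \<open>norm h * d\<close>.\<close>
    define d where "d = e / DIM('v)"
    have "d > 0" using that by (simp add: d_def)
    have "\<forall>\<^sub>F n in sequentially. \<forall>b\<in>Basis. \<forall>x\<in>S. dist (\<Sum>i<n. D i x b) (\<Sum>i. D i x b) < d"
      using uniform_limitD[OF unif \<open>d > 0\<close>] by (simp add: eventually_ball_finite_distrib)
    then show ?thesis
    proof eventually_elim
      case (elim n)
      show ?case
      proof (intro ballI allI)
        fix x h assume x: "x \<in> S"
        have "(\<Sum>i<n. D i x h) = (\<Sum>b\<in>Basis. (h \<bullet> b) * (\<Sum>i<n. D i x b))"
          unfolding lin[OF x, of _ h] sum_distrib_left by (rule sum.swap)
        then have "(\<Sum>i<n. D i x h) - g' x h
            = (\<Sum>b\<in>Basis. (h \<bullet> b) * ((\<Sum>i<n. D i x b) - (\<Sum>i. D i x b)))"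
          by (simp add: g'_def right_diff_distrib sum_subtractf)
        also have "norm \<dots> \<le> (\<Sum>b\<in>(Basis::'v set). norm h * d)"
        proof (rule sum_norm_le)
          fix b :: 'v assume b: "b \<in> Basis"
          have "\<bar>h \<bullet> b\<bar> * \<bar>(\<Sum>i<n. D i x b) - (\<Sum>i. D i x b)\<bar> \<le> norm h * d"
            using elim x b by (intro mult_mono) (auto simp: dist_real_def Basis_le_norm less_imp_le)
          then show "norm ((h \<bullet> b) * ((\<Sum>i<n. D i x b) - (\<Sum>i. D i x b))) \<le> norm h * d"
            by (simp add: abs_mult)
        qed
        also have "\<dots> = e * norm h" by (simp add: d_def)
        finally show "norm ((\<Sum>i<n. D i x h) - g' x h) \<le> e * norm h" .
      qed
    qed
  qed
  have "\<exists>g. \<forall>x\<in>S. (\<lambda>n. f n x) sums (g x) \<and> (g has_derivative g' x) (at x within S)"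
  proof (rule has_derivative_series[OF \<open>convex S\<close> _ main \<open>x \<in> S\<close>])
    show "(f n has_derivative D n x) (at x within S)" if "x \<in> S" for n x
      using diff[OF that] unfolding D_def
      by (simp add: has_derivative_at_withinI frechet_derivative_works)
    show "(\<lambda>n. f n x) sums (\<Sum>n. f n x)" using sm[OF \<open>x \<in> S\<close>] by auto
  qed
  then obtain g where g: "\<And>x. x \<in> S \<Longrightarrow> (\<lambda>n. f n x) sums (g x)"
     "\<And>x. x \<in> S \<Longrightarrow> (g has_derivative g' x) (at x within S)" by blast
  have "(g has_derivative g' x) (at x)"
    using g(2)[OF \<open>x \<in> S\<close>] at_within_open[OF \<open>x \<in> S\<close> \<open>open S\<close>] by simp
  then have "((\<lambda>x. \<Sum>n. f n x) has_derivative g' x) (at x)"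
    by (rule has_derivative_transform_within_open[OF _ \<open>open S\<close> \<open>x \<in> S\<close>]) (use g(1) sums_unique in blast)
  then show ?thesis by (simp add: g'_def[abs_def] D_def)
qed

text \<open>The invariant \<open>?P\<close> passes from a family of functions to the family of its
  partial derivatives. Hence the first-order result can be repeated, by induction on the order for
  smoothness and on the list for the values of the derivatives.\<close>

lemma
  fixes f :: "nat \<Rightarrow> 'v::euclidean_space \<Rightarrow> real"
  assumes "open S" "convex S"
    and sm: "\<And>n. smooth_on S (f n)"
    and bd: "\<And>l. set l \<subseteq> Basis \<Longrightarrow> \<exists>M. summable M \<and>
        (\<forall>\<^sub>F n in sequentially. \<forall>x\<in>S. \<bar>iter_deriv l (f n) x\<bar> \<le> M n)"
  shows smooth_on_suminf: "smooth_on S (\<lambda>x. \<Sum>n. f n x)"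
    and sums_iter_deriv: "\<And>l x. set l \<subseteq> Basis \<Longrightarrow> x \<in> S \<Longrightarrow>
      (\<lambda>n. iter_deriv l (f n) x) sums iter_deriv l (\<lambda>x. \<Sum>n. f n x) x"
proof -
  let ?P = "\<lambda>f :: nat \<Rightarrow> 'v \<Rightarrow> real. (\<forall>n. smooth_on S (f n)) \<and> (\<forall>l. set l \<subseteq> Basis \<longrightarrow> (\<exists>M. summable M \<and>
        (\<forall>\<^sub>F n in sequentially. \<forall>x\<in>S. \<bar>iter_deriv l (f n) x\<bar> \<le> M n)))"
  have summ: "summable (\<lambda>n. f n x)" if P: "?P f" and x: "x \<in> S" for f x
  proof -
    obtain M where "summable M" "\<forall>\<^sub>F n in sequentially. \<forall>x\<in>S. \<bar>iter_deriv [] (f n) x\<bar> \<le> M n"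
      using P[THEN conjunct2, rule_format, of "[]"] by auto
    then show ?thesis
      using x by (intro summable_comparison_test_ev[of "\<lambda>n. f n x" M]) (auto elim: eventually_mono)
  qed
  have step: "?P (\<lambda>n x. frechet_derivative (f n) (at x) b)" if "?P f" "b \<in> Basis" for f b
  proof (intro conjI allI impI)
    show "smooth_on S (\<lambda>x. frechet_derivative (f n) (at x) b)" for n
      using that smooth_onD(3) by blast
    fix l :: "'v list" assume "set l \<subseteq> Basis"
    then have "set (b # l) \<subseteq> Basis" using that by auto
    then show "\<exists>M. summable M \<and> (\<forall>\<^sub>F n in sequentially.
        \<forall>x\<in>S. \<bar>iter_deriv l (\<lambda>x. frechet_derivative (f n) (at x) b) x\<bar> \<le> M n)"
      using that(1)[THEN conjunct2, rule_format, of "b # l"] by simp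
  qed
  have der: "((\<lambda>x. \<Sum>n. f n x) has_derivative
     (\<lambda>h. \<Sum>b\<in>Basis. (h \<bullet> b) * (\<Sum>n. frechet_derivative (f n) (at x) b))) (at x)"
    if "?P f" "x \<in> S" for f x
  proof (rule has_derivative_suminf_partials[OF assms(1,2) that(2)])
    show "f n differentiable (at y)" if "y \<in> S" for n y
      using smooth_onD(2) \<open>?P f\<close> that by blast
    show "summable (\<lambda>n. f n y)" if "y \<in> S" for y
      using summ \<open>?P f\<close> that by blast
    show "\<exists>M. summable M \<and> (\<forall>\<^sub>F n in sequentially. \<forall>x\<in>S. \<bar>frechet_derivative (f n) (at x) b\<bar> \<le> M n)"
      if "b \<in> Basis" for b
      using step[OF \<open>?P f\<close> that, THEN conjunct2, rule_format, of "[]"] by simp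
  qed
  have fd: "frechet_derivative (\<lambda>x. \<Sum>n. f n x) (at x) b = (\<Sum>n. frechet_derivative (f n) (at x) b)"
    if "?P f" "x \<in> S" "b \<in> Basis" for f x b
  proof -
    have "frechet_derivative (\<lambda>x. \<Sum>n. f n x) (at x) b
       = (\<Sum>c\<in>Basis. (b \<bullet> c) * (\<Sum>n. frechet_derivative (f n) (at x) c))"
      by (rule fun_cong[OF frechet_derivative_at[OF der[OF that(1,2)]], symmetric])
    also have "\<dots> = (\<Sum>n. frechet_derivative (f n) (at x) b)"
      using that(3) by (simp add: inner_Basis if_distrib[of "\<lambda>z. z * _"] cong: if_cong)
    finally show ?thesis .
  qed
  have "Ck_on k S (\<lambda>x. \<Sum>n. f n x)" if "?P f" for k f
    using that
  proof (induction k arbitrary: f)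
    case 0
    then show ?case
      using der by (auto intro!: continuous_at_imp_continuous_on has_derivative_continuous)
  next
    case (Suc k)
    have "Ck_on k S (\<lambda>x. frechet_derivative (\<lambda>x. \<Sum>n. f n x) (at x) b)" if "b \<in> Basis" for b
    proof -
      have "Ck_on k S (\<lambda>x. (\<Sum>n. frechet_derivative (f n) (at x) b))"
        by (rule Suc.IH[OF step[OF Suc.prems that]])
      then show ?thesis
        by (rule Ck_on_eqI[OF assms(1)]) (rule fd[OF Suc.prems _ that])
    qed
    moreover have "continuous_on S (\<lambda>x. \<Sum>n. f n x)"
      using der[OF Suc.prems] by (auto intro!: continuous_at_imp_continuous_on has_derivative_continuous)
    ultimately show ?case
      using der[OF Suc.prems] unfolding Ck_on.simps differentiable_def by blast
  qed
  then show "smooth_on S (\<lambda>x. \<Sum>n. f n x)"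
    using sm bd unfolding smooth_on_def by blast
  have "(\<lambda>n. iter_deriv l (f n) x) sums iter_deriv l (\<lambda>x. \<Sum>n. f n x) x"
    if "?P f" "set l \<subseteq> Basis" "x \<in> S" for l x f
    using that(1,2)
  proof (induction l arbitrary: f)
    case Nil
    then show ?case using summ that(3) by auto
  next
    case (Cons b l)
    have b: "b \<in> Basis" using Cons.prems by auto
    have "(\<lambda>n. iter_deriv l (\<lambda>x. frechet_derivative (f n) (at x) b) x) sums
        iter_deriv l (\<lambda>x. \<Sum>n. frechet_derivative (f n) (at x) b) x"
      using Cons.prems by (intro Cons.IH step) auto
    also have "iter_deriv l (\<lambda>x. \<Sum>n. frechet_derivative (f n) (at x) b) x
       = iter_deriv l (\<lambda>x. frechet_derivative (\<lambda>x. \<Sum>n. f n x) (at x) b) x"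
      using fd[OF Cons.prems(1) _ b] by (intro iter_deriv_cong[OF assms(1) _ that(3)]) auto
    finally show ?case by simp
  qed
  then show "\<And>l x. set l \<subseteq> Basis \<Longrightarrow> x \<in> S \<Longrightarrow>
      (\<lambda>n. iter_deriv l (f n) x) sums iter_deriv l (\<lambda>x. \<Sum>n. f n x) x"
    using sm bd by blast
qed

section \<open>A smooth step function\<close>

text \<open>With z = 1 / y, the derivative in y of q(z) exp(-z) is z^2 (q(z) - q'(z)) exp(-z), which
  is the recursion used here.\<close>

fun flat_poly :: "nat \<Rightarrow> real poly" where
  "flat_poly 0 = 1"
| "flat_poly (Suc m) = [:0, 0, 1:] * (flat_poly m - pderiv (flat_poly m))"

text \<open>\<open>flat_exp m\<close> is the \<open>m\<close>-th derivative of the function that is \<open>exp (- 1 / y)\<close> for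
  \<open>y > 0\<close> and \<open>0\<close> otherwise.\<close>
definition flat_exp :: "nat \<Rightarrow> real \<Rightarrow> real" where
  "flat_exp m y = (if y > 0 then poly (flat_poly m) (1 / y) * exp (- 1 / y) else 0)"

lemma tendsto_poly_mult_exp_neg:
  fixes q :: "real poly"
  shows "((\<lambda>z. poly q z * exp (- z)) \<longlongrightarrow> 0) at_top"
proof -
  have "((\<lambda>z. \<Sum>i\<le>degree q. coeff q i * (z ^ i / exp z)) \<longlongrightarrow> (\<Sum>i\<le>degree q. coeff q i * 0)) at_top"
    by (intro tendsto_intros tendsto_power_div_exp_0)
  moreover have "(\<lambda>z. \<Sum>i\<le>degree q. coeff q i * (z ^ i / exp z)) = (\<lambda>z. poly q z * exp (- z))"
    unfolding poly_altdef sum_distrib_right exp_minus divide_inverse by (simp add: mult.assoc)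
  ultimately show ?thesis by simp
qed

lemma flat_exp_has_derivative:
  "(flat_exp m has_real_derivative flat_exp (Suc m) y) (at y)"
proof -
  consider "y > 0" | "y < 0" | "y = 0" by linarith
  then show ?thesis
  proof cases
    case 1
    have "((\<lambda>y. poly (flat_poly m) (1 / y) * exp (- 1 / y)) has_real_derivative flat_exp (Suc m) y) (at y)"
      using 1 by (auto intro!: derivative_eq_intros poly_DERIV[THEN DERIV_chain2]
          simp: flat_exp_def field_simps power2_eq_square)
    then show ?thesis
      by (rule has_field_derivative_transform_within_open[of _ _ _ "{0<..}"])
        (use 1 in \<open>auto simp: flat_exp_def\<close>)
  next
    case 2
    have "((\<lambda>y. 0) has_real_derivative flat_exp (Suc m) y) (at y)"
      using 2 by (simp add: flat_exp_def)
    then show ?thesis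
      by (rule has_field_derivative_transform_within_open[of _ _ _ "{..<0}"])
        (use 2 in \<open>auto simp: flat_exp_def\<close>)
  next
    case 3
    \<comment> \<open>With z = 1 / h the right difference quotient at 0 is z q(z) exp(-z);
      \<open>pCons 0\<close> supplies the extra factor z.\<close>
    have "((\<lambda>z. poly (pCons 0 (flat_poly m)) z * exp (- z)) \<longlongrightarrow> 0) at_top"
      by (rule tendsto_poly_mult_exp_neg)
    from filterlim_compose[OF this filterlim_inverse_at_top_right]
    have "((\<lambda>h. flat_exp m h / h) \<longlongrightarrow> 0) (at_right 0)"
      by (rule Lim_transform_eventually)
        (auto simp: eventually_at_filter flat_exp_def field_simps)
    moreover have "((\<lambda>h. flat_exp m h / h) \<longlongrightarrow> 0) (at_left 0)"
      by (rule Lim_transform_eventually[OF tendsto_const])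
        (auto simp: eventually_at_filter flat_exp_def)
    ultimately have "((\<lambda>h. flat_exp m h / h) \<longlongrightarrow> 0) (at 0)"
      by (simp add: filterlim_split_at)
    then show ?thesis
      unfolding 3 DERIV_def by (simp add: flat_exp_def)
  qed
qed

lemma flat_exp_0: "flat_exp 0 y = (if y > 0 then exp (- 1 / y) else 0)"
  by (simp add: flat_exp_def)

lemma flat_exp_1: "flat_exp (Suc 0) y = (if y > 0 then (1 / y)\<^sup>2 * exp (- 1 / y) else 0)"
  by (simp add: flat_exp_def power2_eq_square)

lemma flat_exp_1_bounds: "0 \<le> flat_exp (Suc 0) y" "flat_exp (Suc 0) y \<le> 2"
proof -
  have "z\<^sup>2 * exp (- z) \<le> 2" if "z > 0" for z :: real
  proof -
    have "z\<^sup>2 / 2 \<le> exp z"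
      using exp_lower_Taylor_quadratic[of z] that by linarith
    then show ?thesis by (simp add: exp_minus field_simps)
  qed
  from this[of "1 / y"] show "flat_exp (Suc 0) y \<le> 2"
    by (simp add: flat_exp_1)
qed (simp add: flat_exp_1)

text \<open>Two nested copies of the flat function. The inner expression is at most 0 for y <= 0 and
  equals 1 for y >= 1; the outer copy sends these to 0 and 1, the factors \<open>exp 1\<close>
  normalising exp(-1). Composition replaces the usual quotient, so the chain rule alone gives
  smoothness.\<close>

definition smooth_step :: "real \<Rightarrow> real" where
  "smooth_step y = exp 1 * flat_exp 0 (1 - exp 1 * flat_exp 0 (1 - y))"

definition smooth_step' :: "real \<Rightarrow> real" where
  "smooth_step' y = (exp 1)\<^sup>2 * flat_exp 1 (1 - exp 1 * flat_exp 0 (1 - y)) * flat_exp 1 (1 - y)"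

lemma smooth_step_inner_nonpos: "y \<le> 0 \<Longrightarrow> 1 - exp 1 * flat_exp 0 (1 - y) \<le> 0"
proof -
  assume "y \<le> 0"
  then have "exp 1 * exp (- 1) \<le> exp 1 * exp (- 1 / (1 - y))"
    by (intro mult_left_mono) (auto simp: field_simps)
  then show ?thesis
    using \<open>y \<le> 0\<close> by (simp add: flat_exp_0 exp_minus)
qed

lemma smooth_step_eq_0: "y \<le> 0 \<Longrightarrow> smooth_step y = 0"
  and smooth_step'_eq_0_left: "y \<le> 0 \<Longrightarrow> smooth_step' y = 0"
  using smooth_step_inner_nonpos[of y]
  by (auto simp: smooth_step_def smooth_step'_def flat_exp_def)

lemma smooth_step_eq_1: "1 \<le> y \<Longrightarrow> smooth_step y = 1"
  and smooth_step'_eq_0_right: "1 \<le> y \<Longrightarrow> smooth_step' y = 0"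
  by (auto simp: smooth_step_def smooth_step'_def flat_exp_def exp_minus)

lemma smooth_step_bounds: "0 \<le> smooth_step y" "smooth_step y \<le> 1"
proof -
  have "flat_exp 0 w \<le> exp (- 1)" if "w \<le> 1" for w
    using that by (auto simp: flat_exp_0 field_simps)
  moreover have "1 - exp 1 * flat_exp 0 (1 - y) \<le> 1"
    by (simp add: flat_exp_0)
  ultimately have "exp 1 * flat_exp 0 (1 - exp 1 * flat_exp 0 (1 - y)) \<le> exp 1 * exp (- 1)"
    by (intro mult_left_mono) auto
  then show "smooth_step y \<le> 1"
    by (simp add: smooth_step_def exp_minus)
qed (simp add: smooth_step_def flat_exp_0)

lemma smooth_step'_bounds: "0 \<le> smooth_step' y" "smooth_step' y \<le> 4 * (exp 1)\<^sup>2"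
proof -
  let ?a = "flat_exp 1 (1 - exp 1 * flat_exp 0 (1 - y))" and ?b = "flat_exp 1 (1 - y)"
  have *: "0 \<le> ?a" "?a \<le> 2" "0 \<le> ?b" "?b \<le> 2"
    using flat_exp_1_bounds by auto
  then show "0 \<le> smooth_step' y"
    by (simp add: smooth_step'_def)
  have "?a * ?b \<le> 2 * 2" using * by (intro mult_mono) auto
  then have "(exp 1)\<^sup>2 * (?a * ?b) \<le> (exp 1)\<^sup>2 * (2 * 2)"
    by (intro mult_left_mono) auto
  then show "smooth_step' y \<le> 4 * (exp 1)\<^sup>2"
    by (simp add: smooth_step'_def ac_simps)
qed

lemma smooth_step_has_derivative:
  "(smooth_step has_real_derivative smooth_step' y) (at y)"
  unfolding smooth_step_def[abs_def] smooth_step'_def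
  by (auto intro!: derivative_eq_intros flat_exp_has_derivative[THEN DERIV_chain2]
      simp: power2_eq_square)

lemma Ck_on_smooth_step:
  assumes "open S" "Ck_on k S f"
  shows "Ck_on k S (\<lambda>x. smooth_step (f x))"
proof -
  have *: "Ck_on k S (\<lambda>x. flat_exp 0 (g x))" if "Ck_on k S g" for g
    using Ck_on_compose_real[of S g UNIV flat_exp k 0] flat_exp_has_derivative assms(1) that by auto
  have aff: "Ck_on k S (\<lambda>x. 1 + c * g x)" if "Ck_on k S g" for c g
    using that by (intro Ck_on_add Ck_on_mult Ck_on_const assms(1))
  have "Ck_on k S (\<lambda>x. exp 1 * flat_exp 0 (1 + (- exp 1) * flat_exp 0 (1 + (- 1) * f x)))"
    using assms by (intro Ck_on_mult Ck_on_const * aff)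
  then show ?thesis by (simp add: smooth_step_def)
qed

section \<open>Pulses of the heat kernel\<close>

lemma Ck_on_powr:
  assumes "open S" "\<And>x. x \<in> S \<Longrightarrow> f x > 0" "Ck_on k S f"
  shows "Ck_on k S (\<lambda>x. f x powr q)"
proof -
  \<comment> \<open>The \<open>m\<close>-th derivative of y^q: a falling factorial times y^(q -
    m).\<close>
  define G where "G m y = (\<Prod>i<m. q - real i) * y powr (q - real m)" for m y
  have "(G m has_real_derivative G (Suc m) y) (at y)" if "y \<in> {0<..}" for m y
    using that unfolding G_def
    by (auto intro!: derivative_eq_intros simp: algebra_simps)
  from Ck_on_compose_real[of S f "{0<..}" G k 0, OF assms(1) _ this assms(3)]
  show ?thesis using assms(2) by (simp add: G_def)
qed

lemma Ck_on_exp: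
  assumes "open S" "Ck_on k S f"
  shows "Ck_on k S (\<lambda>x. exp (f x))"
  using Ck_on_compose_real[of S f UNIV "\<lambda>_. exp" k 0] assms DERIV_exp by simp

lemma Ck_on_norm_fst_square:
  "Ck_on k S (\<lambda>p :: 'a::euclidean_space \<times> real. (norm (fst p))\<^sup>2)" if "open S"
proof -
  have "Ck_on k S (\<lambda>p :: 'a \<times> real. \<Sum>b\<in>Basis. (fst p \<bullet> b) * (fst p \<bullet> b))"
    by (intro Ck_on_sum Ck_on_mult that Ck_on_bounded_linear
        bounded_linear_compose[OF bounded_linear_inner_left bounded_linear_fst])
  then show ?thesis
    by (simp add: power2_norm_eq_inner flip: euclidean_inner)
qed

lemma Ck_on_snd_affine: "open S \<Longrightarrow> Ck_on k S (\<lambda>p :: 'a::euclidean_space \<times> real. (snd p + c) * d)"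
  by (intro Ck_on_add Ck_on_mult Ck_on_const Ck_on_bounded_linear bounded_linear_snd)

lemma Ck_on_heat_kernel:
  assumes "open S" "\<And>p. p \<in> S \<Longrightarrow> snd p + c > 0"
  shows "Ck_on k S (\<lambda>p :: 'a::euclidean_space \<times> real. heat_kernel (fst p) (snd p + c))"
proof -
  \<comment> \<open>Division by the time is expressed as the power -1, so that the closure rules
    apply.\<close>
  have "Ck_on k S (\<lambda>p. ((snd p + c) * (4 * pi)) powr (- real DIM('a) / 2) *
      exp ((norm (fst p))\<^sup>2 * ((- 1 / 4) * ((snd p + c) * 1) powr (- 1))))"
    using assms
    by (intro Ck_on_mult Ck_on_exp Ck_on_powr Ck_on_norm_fst_square Ck_on_snd_affine Ck_on_const) auto
  then show ?thesis
    by (rule Ck_on_eqI[OF assms(1)])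
      (use assms(2) in \<open>fastforce simp: heat_kernel_def powr_minus_divide mult.commute\<close>)
qed

text \<open>The time shift by \<open>r\<^sup>2\<close> keeps the kernel away from its singularity:
  wherever the switch is nonzero, the kernel time exceeds r^2.\<close>

definition pulse :: "real \<Rightarrow> real \<Rightarrow> real \<Rightarrow> 'a::euclidean_space \<times> real \<Rightarrow> real" where
  "pulse r s a p = a * smooth_step ((snd p - s) / r\<^sup>2) * heat_kernel (fst p) (snd p - s + r\<^sup>2)"

lemma open_snd_gt: "open {p :: 'a::topological_space \<times> real. snd p > c}"
  and open_snd_lt: "open {p :: 'a::topological_space \<times> real. snd p < c}"
  by (intro open_Collect_less continuous_intros)+

text \<open>Two overlapping open half-spaces cover everything: for t > s - r^2 the kernel is smooth,
  and for t < s the pulse vanishes.\<close>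

lemma smooth_on_pulse:
  assumes "r > 0"
  shows "smooth_on UNIV (pulse r s a :: 'a::euclidean_space \<times> real \<Rightarrow> real)"
  unfolding smooth_on_def
proof
  fix k
  have r2: "r\<^sup>2 > 0" using assms by simp
  let ?A = "{p :: 'a \<times> real. snd p > s - r\<^sup>2}" and ?B = "{p :: 'a \<times> real. snd p < s}"
  have "Ck_on k ?A (\<lambda>p. a * smooth_step ((snd p + (- s)) * (1 / r\<^sup>2)) * heat_kernel (fst p) (snd p + (r\<^sup>2 - s)))"
    by (intro Ck_on_mult Ck_on_const Ck_on_heat_kernel Ck_on_smooth_step Ck_on_snd_affine open_snd_gt) auto
  then have A: "Ck_on k ?A (pulse r s a)"
    by (rule Ck_on_eqI[OF open_snd_gt]) (simp add: pulse_def algebra_simps)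
  have B: "Ck_on k ?B (pulse r s a)"
    by (rule Ck_on_eqI[OF open_snd_lt Ck_on_const[of _ _ 0]])
      (use assms in \<open>auto simp: pulse_def smooth_step_eq_0 divide_nonpos_pos\<close>)
  have "Ck_on k (\<Union>{?A, ?B}) (pulse r s a)"
    using A B by (intro Ck_on_Union) (auto simp: open_snd_gt open_snd_lt)
  moreover have "\<Union>{?A, ?B} = UNIV"
  proof -
    have "s - r\<^sup>2 < t \<or> t < s" for t using r2 by linarith
    then show ?thesis by auto
  qed
  ultimately show "Ck_on k UNIV (pulse r s a :: 'a \<times> real \<Rightarrow> real)" by metis
qed

section \<open>Derivatives of the kernel and the heat operator on a pulse\<close>

lemma frechet_derivative_eq_line:
  fixes f :: "'v::euclidean_space \<Rightarrow> real"
  assumes "f differentiable (at p)" "((\<lambda>h. f (p + h *\<^sub>R b)) has_real_derivative d) (at 0)"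
  shows "frechet_derivative f (at p) b = d"
proof -
  have f: "(f has_derivative frechet_derivative f (at p)) (at (p + 0 *\<^sub>R b))"
    using assms(1) by (simp add: frechet_derivative_works)
  have "((\<lambda>h. p + h *\<^sub>R b) has_derivative (\<lambda>h. h *\<^sub>R b)) (at 0)"
    by (auto intro!: derivative_eq_intros)
  from has_derivative_compose[OF this f]
  have "((\<lambda>h. f (p + h *\<^sub>R b)) has_derivative (\<lambda>h. frechet_derivative f (at p) (h *\<^sub>R b))) (at 0)" .
  moreover have "((\<lambda>h. f (p + h *\<^sub>R b)) has_derivative (\<lambda>h. d * h)) (at 0)"
    using assms(2) by (simp add: has_field_derivative_def)
  ultimately have "(\<lambda>h. frechet_derivative f (at p) (h *\<^sub>R b)) = (\<lambda>h. d * h)"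
    by (rule has_derivative_unique)
  from fun_cong[OF this, of 1] show ?thesis by simp
qed

lemma heat_kernel_space_derivative:
  fixes x b :: "'a::euclidean_space"
  assumes "b \<in> Basis" "t > 0"
  shows "((\<lambda>h. heat_kernel (x + h *\<^sub>R b) t) has_real_derivative
      - (x \<bullet> b) / (2 * t) * heat_kernel x t) (at 0)"
proof -
  have "(norm (x + h *\<^sub>R b))\<^sup>2 = (norm x)\<^sup>2 + 2 * h * (x \<bullet> b) + h\<^sup>2" for h
    using assms(1) unfolding power2_norm_eq_inner
    by (simp add: inner_add_left inner_add_right inner_commute algebra_simps power2_eq_square)
  then have "(\<lambda>h. heat_kernel (x + h *\<^sub>R b) t) = (\<lambda>h. (4 * pi * t) powr (- real DIM('a) / 2) *
      exp (- ((norm x)\<^sup>2 + 2 * h * (x \<bullet> b) + h\<^sup>2) / (4 * t)))"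
    using assms(2) by (simp add: heat_kernel_def)
  then show ?thesis
    using assms(2) by (auto intro!: derivative_eq_intros simp: heat_kernel_def field_simps)
qed

lemma heat_kernel_time_derivative:
  fixes x :: "'a::euclidean_space"
  assumes "t > 0"
  shows "((\<lambda>h. heat_kernel x (t + h)) has_real_derivative
      ((norm x)\<^sup>2 / (4 * t\<^sup>2) - real DIM('a) / (2 * t)) * heat_kernel x t) (at 0)"
proof -
  let ?q = "- real DIM('a) / 2"
  have "((\<lambda>h. (4 * pi * (t + h)) powr ?q) has_real_derivative ?q / t * (4 * pi * t) powr ?q) (at 0)"
  proof -
    have "(4 * pi * t) powr (?q - 1) = (4 * pi * t) powr ?q / (4 * pi * t)"
      using assms by (simp add: powr_diff)
    then show ?thesis
      using assms by (auto intro!: derivative_eq_intros)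
  qed
  moreover have "((\<lambda>h. exp (- (norm x)\<^sup>2 / (4 * (t + h)))) has_real_derivative
      (norm x)\<^sup>2 / (4 * t\<^sup>2) * exp (- (norm x)\<^sup>2 / (4 * t))) (at 0)"
    using assms by (auto intro!: derivative_eq_intros simp: field_simps power2_eq_square)
  ultimately have "((\<lambda>h. (4 * pi * (t + h)) powr ?q * exp (- (norm x)\<^sup>2 / (4 * (t + h))))
      has_real_derivative ((norm x)\<^sup>2 / (4 * t\<^sup>2) - real DIM('a) / (2 * t)) * heat_kernel x t) (at 0)"
    by (rule DERIV_cong[OF DERIV_mult])
      (use assms in \<open>simp add: heat_kernel_def algebra_simps\<close>)
  then show ?thesis
    by (rule has_field_derivative_transform_within_open[of _ _ _ "{- t<..}"])
      (use assms in \<open>auto simp: heat_kernel_def\<close>)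
qed

text \<open>The kernel solves the heat equation at positive times, so the product rule leaves only
  the term in which the time derivative hits the switch.\<close>

lemma heat_operator_pulse:
  fixes p :: "'a::euclidean_space \<times> real"
  assumes "r > 0"
  shows "time_deriv (pulse r s a) p - space_laplacian (pulse r s a) p
    = a * smooth_step' ((snd p - s) / r\<^sup>2) / r\<^sup>2 * heat_kernel (fst p) (snd p - s + r\<^sup>2)"
proof (cases "snd p - s + r\<^sup>2 > 0")
  case False
  let ?B = "{p :: 'a \<times> real. snd p < s}"
  have r2: "r\<^sup>2 > 0" using assms by simp
  \<comment> \<open>Without positive kernel time \<open>p\<close> lies strictly before the switch-on
    time, where the pulse vanishes identically.\<close>
  then have "p \<in> ?B" using False unfolding mem_Collect_eq by linarith
  have z: "frechet_derivative (pulse r s a) (at q) = (\<lambda>_. 0)" if "q \<in> ?B" for q :: "'a \<times> real"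
  proof -
    have "frechet_derivative (pulse r s a) (at q) = frechet_derivative (\<lambda>_. 0) (at q)"
      by (rule frechet_derivative_cong_open[OF open_snd_lt that])
        (use assms in \<open>auto simp: pulse_def smooth_step_eq_0 divide_nonpos_pos\<close>)
    then show ?thesis by simp
  qed
  have "frechet_derivative (\<lambda>q. frechet_derivative (pulse r s a) (at q) c) (at p)
      = frechet_derivative (\<lambda>_. 0) (at p)" for c
    by (rule frechet_derivative_cong_open[OF open_snd_lt \<open>p \<in> ?B\<close>]) (use z in auto)
  then show ?thesis
    using z[OF \<open>p \<in> ?B\<close>] False by (simp add: time_deriv_def space_laplacian_def heat_kernel_def)
next
  case True
  let ?A = "{p :: 'a \<times> real. snd p > s - r\<^sup>2}"
  obtain x t where p: "p = (x, t)" by (cases p)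
  define \<tau> where "\<tau> = t - s + r\<^sup>2"
  have \<tau>: "\<tau> > 0" using True by (simp add: p \<tau>_def)
  have sm: "smooth_on UNIV (pulse r s a :: 'a \<times> real \<Rightarrow> real)"
    by (rule smooth_on_pulse[OF assms])
  define m where "m = smooth_step ((t - s) / r\<^sup>2)"
  have time: "time_deriv (pulse r s a) p = a * smooth_step' ((t - s) / r\<^sup>2) / r\<^sup>2 * heat_kernel x \<tau>
      + a * m * (((norm x)\<^sup>2 / (4 * \<tau>\<^sup>2) - real DIM('a) / (2 * \<tau>)) * heat_kernel x \<tau>)"
    unfolding time_deriv_def
  proof (rule frechet_derivative_eq_line)
    have "((\<lambda>h. smooth_step ((t + h - s) / r\<^sup>2)) has_real_derivative smooth_step' ((t - s) / r\<^sup>2) / r\<^sup>2) (at 0)"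
      by (rule DERIV_cong[OF DERIV_chain2[OF smooth_step_has_derivative]])
        (use assms in \<open>auto intro!: derivative_eq_intros simp: power2_eq_square\<close>)
    note DERIV_mult[OF DERIV_cmult[OF this, of a] heat_kernel_time_derivative[OF \<tau>, of x]]
    then show "((\<lambda>h. pulse r s a (p + h *\<^sub>R (0, 1))) has_real_derivative
      a * smooth_step' ((t - s) / r\<^sup>2) / r\<^sup>2 * heat_kernel x \<tau>
      + a * m * (((norm x)\<^sup>2 / (4 * \<tau>\<^sup>2) - real DIM('a) / (2 * \<tau>)) * heat_kernel x \<tau>)) (at 0)"
      by (simp add: pulse_def p \<tau>_def m_def algebra_simps)
  qed (use smooth_onD(2)[OF sm] in auto)
  \<comment> \<open>Stated on the whole half-space, not only at \<open>p\<close>, because it is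
    differentiated once more.\<close>
  have first: "frechet_derivative (pulse r s a) (at q) (b, 0)
      = - (fst q \<bullet> b) / (2 * (snd q - s + r\<^sup>2)) * pulse r s a q"
    if q: "q \<in> ?A" and b: "b \<in> Basis" for q and b :: 'a
  proof (rule frechet_derivative_eq_line)
    have "snd q - s + r\<^sup>2 > 0" using q by simp
    from DERIV_cmult[OF heat_kernel_space_derivative[OF b this, of "fst q"], of "a * smooth_step ((snd q - s) / r\<^sup>2)"]
    show "((\<lambda>h. pulse r s a (q + h *\<^sub>R (b, 0))) has_real_derivative
      - (fst q \<bullet> b) / (2 * (snd q - s + r\<^sup>2)) * pulse r s a q) (at 0)"
      by (simp add: pulse_def ac_simps)
  qed (use smooth_onD(2)[OF sm] in auto)
  have pA: "p \<in> ?A" using True by simp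
  have second: "frechet_derivative (\<lambda>q. frechet_derivative (pulse r s a) (at q) (b, 0)) (at p) (b, 0)
      = ((x \<bullet> b)\<^sup>2 / (4 * \<tau>\<^sup>2) - 1 / (2 * \<tau>)) * (a * m * heat_kernel x \<tau>)"
    if b: "b \<in> Basis" for b
  proof (rule frechet_derivative_eq_line)
    have "(b, 0) \<in> (Basis :: ('a \<times> real) set)" using b by (simp add: Basis_prod_def)
    from smooth_onD(2)[OF smooth_onD(3)[OF sm this]]
    show "(\<lambda>q. frechet_derivative (pulse r s a) (at q) (b, 0)) differentiable (at p)" by simp
    have "((\<lambda>h. - (x \<bullet> b + h) / (2 * \<tau>)) has_real_derivative - 1 / (2 * \<tau>)) (at 0)"
      using \<tau> by (auto intro!: derivative_eq_intros)
    note DERIV_mult[OF this DERIV_cmult[OF heat_kernel_space_derivative[OF b \<tau>, of x], of "a * m"]]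
    then have "((\<lambda>h. - (x \<bullet> b + h) / (2 * \<tau>) * (a * m * heat_kernel (x + h *\<^sub>R b) \<tau>)) has_real_derivative
      ((x \<bullet> b)\<^sup>2 / (4 * \<tau>\<^sup>2) - 1 / (2 * \<tau>)) * (a * m * heat_kernel x \<tau>)) (at 0)"
      by (rule DERIV_cong) (use \<tau> in \<open>simp add: field_simps power2_eq_square\<close>)
    moreover have "(\<lambda>h. frechet_derivative (pulse r s a) (at (p + h *\<^sub>R (b, 0))) (b, 0))
       = (\<lambda>h. - (x \<bullet> b + h) / (2 * \<tau>) * (a * m * heat_kernel (x + h *\<^sub>R b) \<tau>))"
    proof
      fix h
      show "frechet_derivative (pulse r s a) (at (p + h *\<^sub>R (b, 0))) (b, 0)
         = - (x \<bullet> b + h) / (2 * \<tau>) * (a * m * heat_kernel (x + h *\<^sub>R b) \<tau>)"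
        using first[of "p + h *\<^sub>R (b, 0)", OF _ b] pA b
        by (simp add: p pulse_def \<tau>_def m_def inner_add_left)
    qed
    ultimately show "((\<lambda>h. frechet_derivative (pulse r s a) (at (p + h *\<^sub>R (b, 0))) (b, 0)) has_real_derivative
      ((x \<bullet> b)\<^sup>2 / (4 * \<tau>\<^sup>2) - 1 / (2 * \<tau>)) * (a * m * heat_kernel x \<tau>)) (at 0)" by simp
  qed
  have "(norm x)\<^sup>2 = (\<Sum>b\<in>Basis. (x \<bullet> b)\<^sup>2)"
    unfolding power2_norm_eq_inner by (subst euclidean_inner) (simp add: power2_eq_square)
  then have "space_laplacian (pulse r s a) p
      = ((norm x)\<^sup>2 / (4 * \<tau>\<^sup>2) - real DIM('a) / (2 * \<tau>)) * (a * m * heat_kernel x \<tau>)"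
    unfolding space_laplacian_def
    by (simp add: second sum_subtractf flip: sum_distrib_right sum_divide_distrib)
  then show ?thesis
    unfolding time by (simp add: p \<tau>_def)
qed

text \<open>The kernel is a product over the coordinates of centred normal densities of variance
  2t.\<close>

lemma nn_integral_heat_kernel:
  assumes "t > 0"
  shows "(\<integral>\<^sup>+x. ennreal (heat_kernel (x :: 'a::euclidean_space) t) \<partial>lborel) = 1"
proof -
  have prod: "heat_kernel x t = (\<Prod>b\<in>Basis. normal_density 0 (sqrt (2 * t)) (x \<bullet> b))" for x :: 'a
  proof -
    have "(norm x)\<^sup>2 = (\<Sum>b\<in>Basis. (x \<bullet> b)\<^sup>2)"
      unfolding power2_norm_eq_inner by (subst euclidean_inner) (simp add: power2_eq_square)
    then have "exp (- (norm x)\<^sup>2 / (4 * t)) = (\<Prod>b\<in>Basis. exp (- (x \<bullet> b)\<^sup>2 / (4 * t)))"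
      by (simp add: sum_negf sum_divide_distrib flip: exp_sum)
    moreover have "(4 * pi * t) powr (- real DIM('a) / 2) = (1 / sqrt (4 * pi * t)) ^ DIM('a)"
    proof -
      have "(4 * pi * t) powr (- real DIM('a) / 2) = ((4 * pi * t) powr (1 / 2)) powr (- real DIM('a))"
        by (simp add: powr_powr)
      also have "\<dots> = sqrt (4 * pi * t) powr (- real DIM('a))"
        using assms by (simp add: powr_half_sqrt)
      finally show ?thesis
        using assms by (simp add: powr_minus powr_realpow field_simps)
    qed
    ultimately show ?thesis
      using assms by (simp add: heat_kernel_def normal_density_def prod_dividef prod.distrib power_divide mult.assoc)
  qed
  have "(\<integral>\<^sup>+x. ennreal (normal_density 0 (sqrt (2 * t)) x) \<partial>lborel) = 1"
    using assms by (subst nn_integral_eq_integral) auto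
  then show ?thesis
    using nn_integral_lborel_prod[of "\<lambda>(_::'a) x. ennreal (normal_density 0 (sqrt (2 * t)) x)"]
    unfolding prod by (subst prod_ennreal[symmetric]) auto
qed

lemma borel_measurable_heat_kernel [measurable (raw)]:
  assumes [measurable]: "f \<in> borel_measurable M" "g \<in> borel_measurable M"
  shows "(\<lambda>z. heat_kernel (f z) (g z)) \<in> borel_measurable M"
  unfolding heat_kernel_def by measurable

section \<open>Size estimates for a single pulse\<close>

text \<open>The prefactor decreases in t and the Gaussian increases, so the two factors are
  estimated at opposite ends of the time interval.\<close>

lemma heat_kernel_le:
  fixes x :: "'a::euclidean_space"
  assumes "0 < A" "A \<le> t" "t \<le> B"
  shows "heat_kernel x t \<le> (4 * pi * A) powr (- real DIM('a) / 2) * exp (- (norm x)\<^sup>2 / (4 * B))"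
proof -
  have "(4 * pi * t) powr (- real DIM('a) / 2) \<le> (4 * pi * A) powr (- real DIM('a) / 2)"
    using assms by (intro powr_mono2') auto
  moreover have "exp (- (norm x)\<^sup>2 / (4 * t)) \<le> exp (- (norm x)\<^sup>2 / (4 * B))"
    using assms by (auto intro!: divide_left_mono)
  ultimately show ?thesis
    using assms by (auto simp: heat_kernel_def intro!: mult_mono)
qed

lemma heat_kernel_ge:
  fixes x :: "'a::euclidean_space"
  assumes "0 < A" "A \<le> t" "t \<le> B"
  shows "(4 * pi * B) powr (- real DIM('a) / 2) * exp (- (norm x)\<^sup>2 / (4 * A)) \<le> heat_kernel x t"
proof -
  have "(4 * pi * B) powr (- real DIM('a) / 2) \<le> (4 * pi * t) powr (- real DIM('a) / 2)"
    using assms by (intro powr_mono2') auto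
  moreover have "exp (- (norm x)\<^sup>2 / (4 * A)) \<le> exp (- (norm x)\<^sup>2 / (4 * t))"
    using assms by (auto intro!: divide_left_mono)
  ultimately show ?thesis
    using assms by (auto simp: heat_kernel_def intro!: mult_mono)
qed

lemma heat_kernel_nonneg: "0 \<le> heat_kernel x t"
  by (simp add: heat_kernel_def)

lemma heat_kernel_pos: "t > 0 \<Longrightarrow> 0 < heat_kernel x t"
  by (simp add: heat_kernel_def)

lemma powr_scale_square:
  assumes "0 < c" "0 < (r::real)"
  shows "(c * r\<^sup>2) powr q = c powr q * r powr (2 * q)"
proof -
  have "r\<^sup>2 = r powr 2" using assms by (simp add: powr_numeral)
  then have "(r\<^sup>2) powr q = r powr (2 * q)" by (simp only: powr_powr)
  then show ?thesis using assms by (simp add: powr_mult)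
qed

lemma pulse_fully_on:
  assumes "0 < r" "s + r\<^sup>2 \<le> t"
  shows "pulse r s a (x, t) = a * heat_kernel x (t - s + r\<^sup>2)"
proof -
  have "1 \<le> (t - s) / r\<^sup>2" using assms by (simp add: le_divide_eq)
  then show ?thesis by (simp add: pulse_def smooth_step_eq_1)
qed

lemma pulse_nonneg: "0 \<le> a \<Longrightarrow> 0 \<le> pulse r s a p"
  by (simp add: pulse_def smooth_step_bounds heat_kernel_nonneg)

text \<open>While the source is active the kernel time lies between r^2 and 2 r^2, which gives the 8
  in the Gaussian. The powers of r add up to (n - 2p) - n - 2.\<close>

lemma pulse_source_le:
  fixes x :: "'a::euclidean_space"
  assumes "0 < r" "s \<le> t" "t \<le> s + r\<^sup>2"
  shows "r powr (real DIM('a) - 2 * p) * smooth_step' ((t - s) / r\<^sup>2) / r\<^sup>2 * heat_kernel x (t - s + r\<^sup>2)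
    \<le> 4 * (exp 1)\<^sup>2 * (4 * pi) powr (- real DIM('a) / 2) * r powr (- 2 * p - 2) * exp (- (norm x)\<^sup>2 / (8 * r\<^sup>2))"
proof -
  have "heat_kernel x (t - s + r\<^sup>2) \<le> (4 * pi * r\<^sup>2) powr (- real DIM('a) / 2) * exp (- (norm x)\<^sup>2 / (4 * (2 * r\<^sup>2)))"
    using assms by (intro heat_kernel_le) auto
  also have "(4 * pi * r\<^sup>2) powr (- real DIM('a) / 2) = (4 * pi) powr (- real DIM('a) / 2) * r powr (- real DIM('a))"
    using assms by (subst powr_scale_square) auto
  finally have hk: "heat_kernel x (t - s + r\<^sup>2) \<le>
      (4 * pi) powr (- real DIM('a) / 2) * r powr (- real DIM('a)) * exp (- (norm x)\<^sup>2 / (8 * r\<^sup>2))"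
    by simp
  have "r powr (real DIM('a) - 2 * p) * smooth_step' ((t - s) / r\<^sup>2) / r\<^sup>2 * heat_kernel x (t - s + r\<^sup>2)
    \<le> r powr (real DIM('a) - 2 * p) * (4 * (exp 1)\<^sup>2) / r\<^sup>2 *
      ((4 * pi) powr (- real DIM('a) / 2) * r powr (- real DIM('a)) * exp (- (norm x)\<^sup>2 / (8 * r\<^sup>2)))"
    by (intro mult_mono divide_right_mono hk smooth_step'_bounds)
      (auto simp: smooth_step'_bounds heat_kernel_nonneg)
  also have "\<dots> = 4 * (exp 1)\<^sup>2 * (4 * pi) powr (- real DIM('a) / 2) *
      (r powr (real DIM('a) - 2 * p) * r powr (- real DIM('a)) / r powr 2) * exp (- (norm x)\<^sup>2 / (8 * r\<^sup>2))"
    using assms by (simp add: powr_numeral)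
  also have "r powr (real DIM('a) - 2 * p) * r powr (- real DIM('a)) / r powr 2 = r powr (- 2 * p - 2)"
    by (simp flip: powr_add powr_diff)
  finally show ?thesis .
qed

text \<open>\<open>A\<close> and \<open>B\<close> bound the kernel time in units of r^2. The
  estimate is used on the windows [2, 5/2] and [3, 4] and at the single value 3, always after the
  switch is complete.\<close>

lemma pulse_ge_scaled:
  fixes x :: "'a::euclidean_space"
  assumes "0 < r" "s + r\<^sup>2 \<le> t" "0 < A" "A * r\<^sup>2 \<le> t - s + r\<^sup>2" "t - s + r\<^sup>2 \<le> B * r\<^sup>2"
  shows "(4 * pi * B) powr (- real DIM('a) / 2) * r powr (- 2 * p) * exp (- (norm x)\<^sup>2 / (4 * A * r\<^sup>2))
    \<le> pulse r s (r powr (real DIM('a) - 2 * p)) (x, t)"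
proof -
  have "A * r\<^sup>2 \<le> B * r\<^sup>2" using assms by linarith
  then have B: "B > 0" using assms by simp
  have "(4 * pi * (B * r\<^sup>2)) powr (- real DIM('a) / 2) * exp (- (norm x)\<^sup>2 / (4 * (A * r\<^sup>2)))
      \<le> heat_kernel x (t - s + r\<^sup>2)"
    using assms by (intro heat_kernel_ge) auto
  also have "(4 * pi * (B * r\<^sup>2)) powr (- real DIM('a) / 2)
      = (4 * pi * B) powr (- real DIM('a) / 2) * r powr (- real DIM('a))"
    using assms B powr_scale_square[of "4 * pi * B" r "- real DIM('a) / 2"] by (simp add: mult.assoc)
  finally have "r powr (real DIM('a) - 2 * p) * ((4 * pi * B) powr (- real DIM('a) / 2) * r powr (- real DIM('a))
      * exp (- (norm x)\<^sup>2 / (4 * A * r\<^sup>2))) \<le> pulse r s (r powr (real DIM('a) - 2 * p)) (x, t)"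
    using assms by (simp add: pulse_fully_on mult_left_mono mult.assoc)
  moreover have "r powr (real DIM('a) - 2 * p) * r powr (- real DIM('a)) = r powr (- 2 * p)"
    by (simp flip: powr_add)
  then have "r powr (real DIM('a) - 2 * p) * ((4 * pi * B) powr (- real DIM('a) / 2) * r powr (- real DIM('a))
      * exp (- (norm x)\<^sup>2 / (4 * A * r\<^sup>2)))
    = (4 * pi * B) powr (- real DIM('a) / 2) * r powr (- 2 * p) * exp (- (norm x)\<^sup>2 / (4 * A * r\<^sup>2))"
  proof -
    have "A * (B' * C * D) = B' * E * D" if "A * C = E" for A B' C D E :: real
      using that by auto
    then show ?thesis using \<open>_ = r powr (- 2 * p)\<close> by blast
  qed
  ultimately show ?thesis by (simp only:)
qed

text \<open>For r = 1, and leaving out the Gaussian in x, the factors are lower bounds for the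
  kernel power and the pulse power, and the measure of the cylinder used in
  \<open>nonlocal_term_ge\<close>.\<close>

definition nonlocal_const :: "'a::euclidean_space itself \<Rightarrow> real \<Rightarrow> real \<Rightarrow> real" where
  "nonlocal_const _ alpha lam = ((8 * pi) powr (- real DIM('a) / 2) * exp (- 1 / 2)) powr (alpha / real DIM('a)) *
     ((10 * pi) powr (- real DIM('a) / 2) * exp (- 1 / 4)) powr lam * unit_ball_vol (real DIM('a)) / 2"

lemma nonlocal_const_pos: "0 < nonlocal_const TYPE('a::euclidean_space) alpha lam"
  by (simp add: nonlocal_const_def)

text \<open>The integral is restricted to a cylinder about x of radius r and duration r^2 / 2, where
  the pulse is fully on and t - \<open>\<tau>\<close> lies between r^2 / 2 and 2 r^2. The measure
  contributes r^(n + 2), the kernel power r^(-alpha), and the power of u contributes r^(-2 p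
  lambda).\<close>

lemma nonlocal_term_ge:
  fixes x :: "'a::euclidean_space" and u :: "'a \<times> real \<Rightarrow> real"
  assumes "0 < r" "0 < alpha" "0 < lam" "0 \<le> s + r\<^sup>2" "s + 2 * r\<^sup>2 \<le> t" "t \<le> s + 3 * r\<^sup>2" "s + 2 * r\<^sup>2 \<le> 1"
    and u: "\<And>y \<tau>. 0 < \<tau> \<Longrightarrow> \<tau> < 1 \<Longrightarrow> pulse r s (r powr (real DIM('a) - 2 * p)) (y, \<tau>) \<le> u (y, \<tau>)"
  shows "ennreal (nonlocal_const TYPE('a) alpha lam * r powr (real DIM('a) + 2 - alpha - 2 * p * lam)
        * exp (- lam * (norm x)\<^sup>2 / (4 * r\<^sup>2)))
     \<le> (\<integral>\<^sup>+ q. ennreal (indicator (UNIV \<times> {0<..<1}) q *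
                 heat_kernel (x - fst q) (t - snd q) powr (alpha / real DIM('a)) *
                 u q powr lam) \<partial>lborel)"
proof -
  let ?n = "real DIM('a)"
  define B where "B = ball x r \<times> {s + r\<^sup>2<..<s + 3 / 2 * r\<^sup>2}"
  define k where "k = ((8 * pi) powr (- ?n / 2) * exp (- 1 / 2)) powr (alpha / ?n) * r powr (- alpha)"
  define w where "w = ((10 * pi) powr (- ?n / 2) * exp (- 1 / 4)) powr lam * r powr (- 2 * p * lam)
     * exp (- lam * (norm x)\<^sup>2 / (4 * r\<^sup>2))"
  have r2: "r\<^sup>2 > 0" using assms by simp
  have "emeasure lborel B = emeasure lborel (ball x r) * emeasure lborel {s + r\<^sup>2<..<s + 3 / 2 * r\<^sup>2}"
    unfolding B_def lborel_prod[symmetric]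
    by (rule lborel.emeasure_pair_measure_Times) auto
  also have "\<dots> = ennreal (unit_ball_vol ?n * r ^ DIM('a) * (r\<^sup>2 / 2))"
    using assms r2 by (simp add: emeasure_ball ennreal_mult'[symmetric] ennreal_mult[symmetric] algebra_simps)
  finally have mB: "emeasure lborel B = ennreal (unit_ball_vol ?n * r ^ DIM('a) * (r\<^sup>2 / 2))" .
  have kw: "k * w \<le> indicator (UNIV \<times> {0<..<1}) q *
                 heat_kernel (x - fst q) (t - snd q) powr (alpha / ?n) * u q powr lam"
    if "q \<in> B" for q
  proof -
    obtain y \<tau> where q: "q = (y, \<tau>)" by (cases q)
    have y: "norm (x - y) < r" and \<tau>: "s + r\<^sup>2 < \<tau>" "\<tau> < s + 3 / 2 * r\<^sup>2"
      using that by (auto simp: q B_def dist_norm)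
    have \<tau>01: "0 < \<tau>" "\<tau> < 1" using \<tau> assms r2 by linarith+
    have "(8 * pi * r\<^sup>2) powr (- ?n / 2) * exp (- 1 / 2)
        \<le> (4 * pi * (2 * r\<^sup>2)) powr (- ?n / 2) * exp (- (norm (x - y))\<^sup>2 / (4 * (r\<^sup>2 / 2)))"
    proof -
      have "(norm (x - y))\<^sup>2 \<le> r\<^sup>2" using y by (intro power_mono) auto
      then have "(norm (x - y))\<^sup>2 / (4 * (r\<^sup>2 / 2)) \<le> 1 / 2" using r2 by (simp add: divide_le_eq)
      then have "- 1 / 2 \<le> - (norm (x - y))\<^sup>2 / (4 * (r\<^sup>2 / 2))" by linarith
      then have "exp (- 1 / 2) \<le> exp (- (norm (x - y))\<^sup>2 / (4 * (r\<^sup>2 / 2)))" by (simp only: exp_le_cancel_iff)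
      then show ?thesis by (simp add: mult_left_mono mult.assoc)
    qed
    also have "\<dots> \<le> heat_kernel (x - y) (t - \<tau>)"
      using \<tau> assms r2 by (intro heat_kernel_ge) linarith+
    finally have "((8 * pi * r\<^sup>2) powr (- ?n / 2) * exp (- 1 / 2)) powr (alpha / ?n)
        \<le> heat_kernel (x - y) (t - \<tau>) powr (alpha / ?n)"
      using assms by (intro powr_mono2) auto
    moreover have "((8 * pi * r\<^sup>2) powr (- ?n / 2) * exp (- 1 / 2)) powr (alpha / ?n) = k"
      using assms by (simp add: k_def powr_mult powr_powr powr_scale_square[of 1 r "- (alpha / 2)", simplified])
    ultimately have K: "k \<le> heat_kernel (x - y) (t - \<tau>) powr (alpha / ?n)" by simp
    \<comment> \<open>Moves the Gaussian from y to x, at the price of a doubled exponent and a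
      constant factor.\<close>
    have "(norm y)\<^sup>2 \<le> 2 * (norm x)\<^sup>2 + 2 * r\<^sup>2"
    proof -
      have "norm y \<le> norm x + r"
        using y norm_triangle_ineq4[of x "x - y"] by simp
      then have "(norm y)\<^sup>2 \<le> (norm x + r)\<^sup>2" by (intro power_mono) auto
      also have "\<dots> \<le> 2 * (norm x)\<^sup>2 + 2 * r\<^sup>2"
        using sum_squares_bound[of "norm x" r] by (simp add: power2_sum)
      finally show ?thesis .
    qed
    then have "(norm y)\<^sup>2 / (8 * r\<^sup>2) \<le> (2 * (norm x)\<^sup>2 + 2 * r\<^sup>2) / (8 * r\<^sup>2)"
      using r2 by (intro divide_right_mono) auto
    also have "\<dots> = (norm x)\<^sup>2 / (4 * r\<^sup>2) + 1 / 4"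
      using r2 by (simp add: field_simps)
    finally have "exp (- (norm x)\<^sup>2 / (4 * r\<^sup>2)) * exp (- 1 / 4) \<le> exp (- (norm y)\<^sup>2 / (8 * r\<^sup>2))"
      by (simp flip: exp_add)
    then have "(10 * pi) powr (- ?n / 2) * r powr (- 2 * p) * (exp (- (norm x)\<^sup>2 / (4 * r\<^sup>2)) * exp (- 1 / 4))
        \<le> (10 * pi) powr (- ?n / 2) * r powr (- 2 * p) * exp (- (norm y)\<^sup>2 / (8 * r\<^sup>2))"
      by (intro mult_left_mono) auto
    also have "\<dots> \<le> pulse r s (r powr (?n - 2 * p)) (y, \<tau>)"
      using pulse_ge_scaled[of r s \<tau> 2 "5 / 2" p y] \<tau> assms r2 by (simp add: field_simps)
    also have "\<dots> \<le> u (y, \<tau>)" using u \<tau>01 by simp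
    finally have "((10 * pi) powr (- ?n / 2) * r powr (- 2 * p) * (exp (- (norm x)\<^sup>2 / (4 * r\<^sup>2)) * exp (- 1 / 4))) powr lam
        \<le> u (y, \<tau>) powr lam"
      using assms by (intro powr_mono2) auto
    moreover have "((10 * pi) powr (- ?n / 2) * r powr (- 2 * p) * (exp (- (norm x)\<^sup>2 / (4 * r\<^sup>2)) * exp (- 1 / 4))) powr lam = w"
    proof -
      have "exp (- (norm x)\<^sup>2 / (4 * r\<^sup>2)) powr lam = exp (- lam * (norm x)\<^sup>2 / (4 * r\<^sup>2))"
        by (simp add: powr_def)
      then show ?thesis
        unfolding w_def by (simp add: powr_mult powr_powr)
    qed
    ultimately have "w \<le> u (y, \<tau>) powr lam" by simp
    then have "k * w \<le> heat_kernel (x - y) (t - \<tau>) powr (alpha / ?n) * u (y, \<tau>) powr lam"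
      using K by (intro mult_mono) (auto simp: k_def w_def)
    then show ?thesis using \<tau>01 by (simp add: q)
  qed
  have "ennreal (nonlocal_const TYPE('a) alpha lam * r powr (?n + 2 - alpha - 2 * p * lam)
        * exp (- lam * (norm x)\<^sup>2 / (4 * r\<^sup>2))) = ennreal (k * w) * emeasure lborel B"
  proof -
    have "r powr (?n + 2 - alpha - 2 * p * lam) = r powr (- alpha) * r powr (- 2 * p * lam) * r ^ DIM('a) * r\<^sup>2"
    proof -
      have "?n + 2 - alpha - 2 * p * lam = - alpha + (- 2 * p * lam) + ?n + 2" by simp
      then show ?thesis
        using assms by (simp only: powr_add powr_realpow powr_numeral)
    qed
    moreover have "K * W * V / 2 * (A * D * N * M) * X = K * A * (W * D * X) * (V * N * (M / 2))"
      for K W V A D N M X :: real by (simp only: times_divide_eq_left times_divide_eq_right ac_simps)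
    ultimately have "nonlocal_const TYPE('a) alpha lam * r powr (?n + 2 - alpha - 2 * p * lam)
        * exp (- lam * (norm x)\<^sup>2 / (4 * r\<^sup>2)) = k * w * (unit_ball_vol ?n * r ^ DIM('a) * (r\<^sup>2 / 2))"
      unfolding nonlocal_const_def k_def w_def by (simp only:)
    moreover have "0 \<le> k * w" by (simp add: k_def w_def)
    ultimately show ?thesis
      unfolding mB by (simp only: ennreal_mult')
  qed
  also have "\<dots> = (\<integral>\<^sup>+ q. ennreal (k * w) * indicator B q \<partial>lborel)"
  proof -
    have "B \<in> sets lborel" unfolding B_def by (auto intro!: borel_open open_Times)
    then show ?thesis by (simp add: nn_integral_cmult_indicator)
  qed
  also have "\<dots> \<le> (\<integral>\<^sup>+ q. ennreal (indicator (UNIV \<times> {0<..<1}) q *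
                 heat_kernel (x - fst q) (t - snd q) powr (alpha / ?n) * u q powr lam) \<partial>lborel)"
    by (rule nn_integral_mono) (use kw in \<open>auto split: split_indicator intro!: ennreal_leI\<close>)
  finally show ?thesis .
qed

text \<open>Write Phi^lambda = Phi^(lambda - 1) Phi. The first factor is at most
  \<open>\<tau>\<close>^(-q) with q = n (lambda - 1) / 2 >= 1, and the second has mass 1 in space.
  For the time integral, \<open>\<tau>\<close>^(-q) is split into \<open>\<tau>\<close>^(-(q - 1 +
  eta)), bounded by its value at r^2, and the integrable \<open>\<tau>\<close>^(eta - 1). The loss
  eta treats the logarithmic case q = 1 together with q > 1.\<close>

lemma nn_integral_pulse_powr_le:
  assumes "0 < r" "r \<le> 1" "- r\<^sup>2 \<le> s" "0 \<le> a" "0 < \<eta>" "\<eta> \<le> 1"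
    and lam: "1 \<le> real DIM('a::euclidean_space) * (lam - 1) / 2"
  shows "(\<integral>\<^sup>+ z. ennreal (indicator (UNIV \<times> {0<..<1}) z * pulse r s a (z :: 'a \<times> real) powr lam) \<partial>lborel)
    \<le> ennreal (4 / \<eta> * a powr lam * r powr (2 - 2 * \<eta> - real DIM('a) * (lam - 1)))"
proof -
  define q where "q = real DIM('a) * (lam - 1) / 2"
  have "lam > 1"
  proof (rule ccontr)
    assume "\<not> lam > 1"
    then have "real DIM('a) * (lam - 1) \<le> 0" by (intro mult_nonneg_nonpos) auto
    then show False using lam by simp
  qed
  define c where "c = a powr lam * r powr (- 2 * (q - 1 + \<eta>))"
  define g where "g t = c * (t - s + r\<^sup>2) powr (\<eta> - 1)" for t
  have r2: "r\<^sup>2 > 0" "r\<^sup>2 \<le> 1" using assms by (auto simp: power_le_one)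
  have c0: "c \<ge> 0" by (simp add: c_def)
  \<comment> \<open>Up to the time s the pulse is 0, and \<open>0 powr lam = 0\<close>. Since s >=
    -1, the window [s, s + 3] contains all remaining times below 1, and its length does not depend
    on s.\<close>
  have pw: "ennreal (indicator (UNIV \<times> {0<..<1}) z * pulse r s a z powr lam)
      \<le> ennreal (g (snd z)) * indicator {s..s + 3} (snd z) * ennreal (heat_kernel (fst z) (snd z - s + r\<^sup>2))"
    for z :: "'a \<times> real"
  proof (cases "0 < snd z \<and> snd z < 1 \<and> s < snd z")
    case False
    then show ?thesis
      using assms r2 \<open>lam > 1\<close> by (cases z) (auto simp: pulse_def smooth_step_eq_0 divide_nonpos_pos split: split_indicator)
  next
    case True
    obtain x t where z: "z = (x, t)" by (cases z)
    define \<tau> where "\<tau> = t - s + r\<^sup>2"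
    have t: "0 < t" "t < 1" "s < t" "t \<in> {s..s + 3}" using True assms r2 by (auto simp: z)
    have \<tau>: "r\<^sup>2 \<le> \<tau>" "0 < \<tau>" using t r2 unfolding \<tau>_def by linarith+
    have "pulse r s a z \<le> a * 1 * heat_kernel x \<tau>"
      unfolding pulse_def z \<tau>_def fst_conv snd_conv
      by (intro mult_right_mono mult_left_mono smooth_step_bounds assms heat_kernel_nonneg)
    then have "pulse r s a z powr lam \<le> (a * heat_kernel x \<tau>) powr lam"
      using \<open>lam > 1\<close> assms by (intro powr_mono2 pulse_nonneg) auto
    also have "\<dots> = a powr lam * (heat_kernel x \<tau> powr (lam - 1) * heat_kernel x \<tau>)"
      using assms heat_kernel_pos[OF \<tau>(2), of x] by (simp add: powr_mult heat_kernel_nonneg powr_diff)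
    also have "heat_kernel x \<tau> powr (lam - 1) \<le> \<tau> powr (- q)"
    proof -
      have "heat_kernel x \<tau> \<le> (4 * pi * \<tau>) powr (- real DIM('a) / 2) * 1"
        using \<tau> unfolding heat_kernel_def by (auto intro!: mult_left_mono divide_nonpos_pos)
      also have "\<dots> \<le> \<tau> powr (- real DIM('a) / 2)"
      proof -
        have "1 * \<tau> \<le> 4 * pi * \<tau>" using \<tau> pi_gt3 by (intro mult_right_mono) auto
        then show ?thesis using \<tau> powr_mono2'[of "- real DIM('a) / 2" \<tau> "4 * pi * \<tau>"] by auto
      qed
      finally have "heat_kernel x \<tau> powr (lam - 1) \<le> (\<tau> powr (- real DIM('a) / 2)) powr (lam - 1)"
        using \<open>lam > 1\<close> by (intro powr_mono2) (auto simp: heat_kernel_nonneg)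
      then show ?thesis by (simp add: powr_powr q_def algebra_simps)
    qed
    also have "\<tau> powr (- q) = \<tau> powr (- (q - 1 + \<eta>)) * \<tau> powr (\<eta> - 1)"
      by (simp flip: powr_add)
    also have "\<tau> powr (- (q - 1 + \<eta>)) \<le> (r\<^sup>2) powr (- (q - 1 + \<eta>))"
      using \<tau> r2 lam assms by (intro powr_mono2') (auto simp: q_def)
    also have "(r\<^sup>2) powr (- (q - 1 + \<eta>)) = r powr (- 2 * (q - 1 + \<eta>))"
      using powr_scale_square[of 1 r "- (q - 1 + \<eta>)"] assms by (simp add: algebra_simps)
    finally have "pulse r s a z powr lam \<le> g t * heat_kernel x \<tau>"
      by (simp add: g_def c_def \<tau>_def mult_left_mono mult_right_mono heat_kernel_nonneg ac_simps)
    then show ?thesis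
      using t c0 by (simp add: z \<tau>_def g_def heat_kernel_nonneg ennreal_leI flip: ennreal_mult)
  qed
  have [measurable]: "g \<in> borel_measurable borel"
    unfolding g_def by measurable
  have P: "pair_sigma_finite (lborel :: 'a measure) (lborel :: real measure)" ..
  have "(\<integral>\<^sup>+ z. ennreal (indicator (UNIV \<times> {0<..<1}) z * pulse r s a (z :: 'a \<times> real) powr lam) \<partial>lborel)
     \<le> (\<integral>\<^sup>+ z. ennreal (g (snd z)) * indicator {s..s + 3} (snd z) *
          ennreal (heat_kernel (fst z) (snd z - s + r\<^sup>2)) \<partial>(lborel \<Otimes>\<^sub>M lborel :: ('a \<times> real) measure))"
    unfolding lborel_prod by (rule nn_integral_mono) (rule pw)
  also have "\<dots> = (\<integral>\<^sup>+ t. \<integral>\<^sup>+ x. ennreal (g t) * indicator {s..s + 3} t *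
          ennreal (heat_kernel (x :: 'a) (t - s + r\<^sup>2)) \<partial>lborel \<partial>lborel)"
  proof -
    define h where "h t = ennreal (g t) * indicator {s..s + 3} t" for t
    have [measurable]: "h \<in> borel_measurable borel"
      unfolding h_def by measurable
    have "(\<lambda>z. h (snd z) * ennreal (heat_kernel (fst z :: 'a) (snd z - s + r\<^sup>2))) \<in> borel_measurable (borel \<Otimes>\<^sub>M borel)"
      by (intro borel_measurable_times_ennreal measurable_compose[OF borel_measurable_heat_kernel measurable_ennreal]
          borel_measurable_add borel_measurable_diff measurable_compose[OF measurable_snd \<open>h \<in> _\<close>]
          measurable_fst measurable_snd borel_measurable_const)
    then have "(\<lambda>z. h (snd z) * ennreal (heat_kernel (fst z :: 'a) (snd z - s + r\<^sup>2))) \<in> borel_measurable (lborel \<Otimes>\<^sub>M lborel)"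
      by (simp cong: measurable_cong_sets sets_pair_measure_cong)
    from pair_sigma_finite.nn_integral_snd[OF P this] show ?thesis
      unfolding h_def[symmetric] by simp
  qed
  also have "\<dots> = (\<integral>\<^sup>+ t. ennreal (g t) * indicator {s..s + 3} t \<partial>lborel)"
  proof (rule nn_integral_cong)
    fix t :: real
    show "(\<integral>\<^sup>+ x. ennreal (g t) * indicator {s..s + 3} t * ennreal (heat_kernel (x :: 'a) (t - s + r\<^sup>2)) \<partial>lborel)
       = ennreal (g t) * indicator {s..s + 3} t"
    proof (cases "t \<in> {s..s + 3}")
      case True
      then have "t - s + r\<^sup>2 > 0" using r2 unfolding atLeastAtMost_iff by linarith
      then show ?thesis
        by (subst nn_integral_cmult) (measurable, simp add: nn_integral_heat_kernel)
    qed simp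
  qed
  also have "\<dots> = ennreal (c / \<eta> * (s + 3 - s + r\<^sup>2) powr \<eta> - c / \<eta> * (s - s + r\<^sup>2) powr \<eta>)"
  proof (rule nn_integral_FTC_Icc)
    fix t assume "t \<in> {s..s + 3}"
    then have "t - s + r\<^sup>2 > 0" using r2 unfolding atLeastAtMost_iff by linarith
    then show "((\<lambda>t. c / \<eta> * (t - s + r\<^sup>2) powr \<eta>) has_real_derivative g t) (at t)"
      using assms by (auto simp: g_def intro!: derivative_eq_intros)
  qed (use c0 in \<open>auto simp: g_def\<close>)
  also have "\<dots> \<le> ennreal (4 / \<eta> * c)"
  proof (rule ennreal_leI)
    have "(3 + r\<^sup>2) powr \<eta> \<le> 4 powr \<eta>" using assms r2 by (intro powr_mono2) auto
    also have "\<dots> \<le> 4 powr 1" using assms by (intro powr_mono) auto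
    finally have "c / \<eta> * (3 + r\<^sup>2) powr \<eta> \<le> c / \<eta> * 4"
      using c0 assms by (intro mult_left_mono) auto
    moreover have "0 \<le> c / \<eta> * (r\<^sup>2) powr \<eta>" using c0 assms by simp
    ultimately show "c / \<eta> * (s + 3 - s + r\<^sup>2) powr \<eta> - c / \<eta> * (s - s + r\<^sup>2) powr \<eta> \<le> 4 / \<eta> * c"
      by (simp add: algebra_simps)
  qed
  also have "4 / \<eta> * c = 4 / \<eta> * a powr lam * r powr (2 - 2 * \<eta> - real DIM('a) * (lam - 1))"
  proof -
    have "- 2 * (q - 1 + \<eta>) = 2 - 2 * \<eta> - real DIM('a) * (lam - 1)"
      by (simp add: q_def)
    then show ?thesis unfolding c_def by (simp only: mult.assoc)
  qed
  finally show ?thesis .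
qed

text \<open>Bounding \<open>v i / w i\<close> by the norm of the whole sequence replaces Minkowski's inequality for series.\<close>
lemma suminf_powr_le:
  fixes v w :: "nat \<Rightarrow> real"
  assumes "0 < lam" "\<And>i. 0 \<le> v i" "\<And>i. 0 < w i" "summable v" "summable w"
  shows "ennreal ((\<Sum>i. v i) powr lam)
    \<le> ennreal ((\<Sum>i. w i) powr lam) * (\<Sum>i. ennreal ((v i / w i) powr lam))"
proof (cases "(\<Sum>i. ennreal ((v i / w i) powr lam)) = top")
  case True
  have "0 < (\<Sum>i. w i)" using assms by (intro suminf_pos) auto
  then show ?thesis by (simp add: True ennreal_mult_top)
next
  case False
  then have "(\<Sum>i. ennreal ((v i / w i) powr lam)) < top" by (rule top.not_eq_extremum[THEN iffD1])
  then obtain S where S: "S \<ge> 0" "(\<Sum>i. ennreal ((v i / w i) powr lam)) = ennreal S"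
    by (auto simp only: less_top_ennreal)
  have W: "0 < (\<Sum>i. w i)" using assms by (intro suminf_pos) auto
  have "v i \<le> w i * S powr (1 / lam)" for i
  proof -
    have "(\<Sum>j\<in>{i}. ennreal ((v j / w j) powr lam)) \<le> (\<Sum>j. ennreal ((v j / w j) powr lam))"
      by (rule sum_le_suminf) auto
    then have "ennreal ((v i / w i) powr lam) \<le> ennreal S"
      unfolding S(2) by simp
    then have "(v i / w i) powr lam \<le> S" using S by (simp add: ennreal_le_iff)
    then have "((v i / w i) powr lam) powr (1 / lam) \<le> S powr (1 / lam)"
      using assms by (intro powr_mono2) auto
    then have "v i / w i \<le> S powr (1 / lam)"
      using assms(1) assms(2)[of i] assms(3)[of i] by (simp add: powr_powr)
    then show ?thesis using assms(3)[of i] by (simp add: field_simps)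
  qed
  then have "(\<Sum>i. v i) \<le> (\<Sum>i. w i * S powr (1 / lam))"
    using assms by (intro suminf_le summable_mult2) auto
  also have "\<dots> = (\<Sum>i. w i) * S powr (1 / lam)"
    using assms by (simp add: suminf_mult2)
  finally have "(\<Sum>i. v i) powr lam \<le> ((\<Sum>i. w i) * S powr (1 / lam)) powr lam"
    using assms by (intro powr_mono2 suminf_nonneg) auto
  also have "\<dots> = (\<Sum>i. w i) powr lam * S"
    using assms S W by (simp add: powr_mult powr_powr)
  finally show ?thesis
    using S W by (simp add: ennreal_leI flip: ennreal_mult)
qed

section \<open>The chain of pulses\<close>

text \<open>The pulses have radii \<open>r i\<close> and switch-on times \<open>s i\<close>. A value \<open>s i = - (r i)\<^sup>2\<close> marks a restart:
  that pulse is fully on for all positive times, so it belongs to the initial data. Otherwise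
  pulse \<open>i + 1\<close> switches on at the time \<open>s i + 2 * (r i)\<^sup>2\<close>, when its predecessor has been
  fully on for a time \<open>(r i)\<^sup>2\<close>.\<close>
locale restart_scales =
  fixes R :: real and r s :: "nat \<Rightarrow> real"
  assumes R2: "2 \<le> R"
    and r0: "0 < r 0" "r 0 \<le> 1 / 2" and r_Suc: "\<And>i. r (Suc i) = r i / R"
    and s0: "s 0 = - (r 0)\<^sup>2"
    and s_Suc: "\<And>i. s (Suc i) = - (r (Suc i))\<^sup>2 \<or> s (Suc i) = s i + 2 * (r i)\<^sup>2"
begin

lemma r_eq: "r i = r 0 * (1 / R) ^ i"
  by (induction i) (auto simp: r_Suc)

lemma r_pos: "0 < r i"
  using r_eq[of i] r0 R2 by simp

lemma r_mono: "i \<le> j \<Longrightarrow> r j \<le> r i"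
  unfolding r_eq[of i] r_eq[of j] using r0 R2 by (intro mult_left_mono power_decreasing) auto

lemma r_le: "r i \<le> 1 / 2"
  using r_mono[of 0 i] r0 by simp

lemma r_tendsto: "r \<longlonglongrightarrow> 0"
proof -
  have "(\<lambda>i. r 0 * (1 / R) ^ i) \<longlonglongrightarrow> r 0 * 0"
    using R2 by (intro tendsto_intros LIMSEQ_power_zero) auto
  then show ?thesis by (simp flip: r_eq)
qed

lemma summable_r_powr:
  assumes "0 < d"
  shows "summable (\<lambda>i. r i powr d)"
proof -
  have eq: "r i powr d = r 0 powr d * ((1 / R) powr d) ^ i" for i
  proof -
    have "((1 / R) ^ i) powr d = ((1 / R) powr d) ^ i"
      using R2 by (simp add: powr_powr mult.commute flip: powr_realpow)
    then show ?thesis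
      using r0 R2 by (subst r_eq) (simp add: powr_mult)
  qed
  have "(1 / R) powr d < 1"
    using R2 assms powr_less_mono2[of d "1 / R" 1] by simp
  then have "summable (\<lambda>i. r 0 powr d * ((1 / R) powr d) ^ i)"
    by (intro summable_mult summable_geometric) simp
  then show ?thesis by (rule summable_cong[THEN iffD2, OF always_eventually, rotated]) (intro allI eq)
qed

lemma r_Suc_square_le: "4 * (r (Suc i))\<^sup>2 \<le> (r i)\<^sup>2"
proof -
  have "2 * r (Suc i) \<le> r i"
    using R2 r_pos[of i] by (simp add: r_Suc field_simps)
  then have "(2 * r (Suc i))\<^sup>2 \<le> (r i)\<^sup>2"
    using r_pos[of "Suc i"] by (intro power_mono) auto
  then show ?thesis by (simp add: power_mult_distrib)
qed

lemma s_ge: "- (r i)\<^sup>2 \<le> s i"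
proof (induction i)
  case (Suc i)
  have "0 \<le> (r i)\<^sup>2" "0 \<le> (r (Suc i))\<^sup>2" by auto
  then show ?case using s_Suc[of i] Suc by argo
qed (simp add: s0)

text \<open>Along a chain s_i + 3 r_i^2 does not increase, because r at least halves and 2 + 3/4 <=
  3. A later restart resets it to 2 r_i^2, which is at most 3 r_m^2.\<close>

lemma s_le_after_restart:
  assumes "s m = - (r m)\<^sup>2" "m \<le> i"
  shows "s i + 3 * (r i)\<^sup>2 \<le> 3 * (r m)\<^sup>2"
  using assms(2)
proof (induction i rule: dec_induct)
  case (step i)
  have "(r i)\<^sup>2 \<le> (r m)\<^sup>2"
    using r_mono[OF step(1)] r_pos[of i] by (intro power_mono) auto
  moreover have "0 \<le> (r (Suc i))\<^sup>2" by simp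
  ultimately show ?case using s_Suc[of i] step(3) r_Suc_square_le[of i] by argo
qed (use assms(1) in auto)

lemma s_le: "s i + 3 * (r i)\<^sup>2 \<le> 3 / 4"
proof -
  have "(r 0)\<^sup>2 \<le> (1 / 2)\<^sup>2" using r0 by (intro power_mono) auto
  then show ?thesis
    using s_le_after_restart[OF s0, of i] by (simp add: power2_eq_square)
qed

text \<open>A restart at m keeps all later switching times below 3 r_m^2, so infinitely many
  restarts force convergence.\<close>

lemma s_tendsto:
  assumes "\<And>m. \<exists>i\<ge>m. s i = - (r i)\<^sup>2"
  shows "s \<longlonglongrightarrow> 0"
proof (rule LIMSEQ_I)
  fix e :: real assume "e > 0"
  have "(\<lambda>i. 3 * (r i)\<^sup>2) \<longlonglongrightarrow> 3 * 0\<^sup>2"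
    by (intro tendsto_intros r_tendsto)
  from order_tendstoD(2)[OF this, of e] \<open>e > 0\<close>
  obtain m where m: "\<And>i. i \<ge> m \<Longrightarrow> 3 * (r i)\<^sup>2 < e"
    by (auto simp: eventually_sequentially)
  obtain j where j: "j \<ge> m" "s j = - (r j)\<^sup>2" using assms by blast
  have "norm (s i - 0) < e" if "i \<ge> j" for i
  proof -
    have "s i + 3 * (r i)\<^sup>2 \<le> 3 * (r j)\<^sup>2" "3 * (r j)\<^sup>2 < e" "3 * (r i)\<^sup>2 < e" "- (r i)\<^sup>2 \<le> s i" "0 \<le> (r i)\<^sup>2"
      using s_le_after_restart[OF j(2) that] m that j(1) s_ge by auto
    then have "s i < e" "- s i < e" by linarith+
    then show ?thesis by simp
  qed
  then show "\<exists>no. \<forall>n\<ge>no. norm (s n - 0) < e" by blast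
qed

end

text \<open>The amplitude of pulse \<open>i\<close> is of order \<open>r i powr (- 2 * p)\<close>. The assumption \<open>gain\<close> compares the
  source that creates pulse \<open>i + 1\<close> with the right-hand side produced by pulse \<open>i\<close> alone; the factor
  \<open>2 ^ (i + 2)\<close> lets the sources of all pulses be added without tracking when they are active.\<close>
locale pulse_chain = restart_scales R r s for R :: real and r s :: "nat \<Rightarrow> real" +
  fixes ty :: "'a::euclidean_space itself" and alpha lam sigma p :: real
  assumes alpha: "0 < alpha" and lam: "(real DIM('a) + 2) / real DIM('a) \<le> lam" and sigma: "0 \<le> sigma"
    and p: "0 < p" "2 * p * lam < real DIM('a) + 2"
    and R_square: "2 * (lam + sigma) \<le> R\<^sup>2"
    and s_lim: "s \<longlonglongrightarrow> 0"
    and gain: "\<And>i. 2 ^ (i + 2) * (4 * (exp 1)\<^sup>2 * (4 * pi) powr (- real DIM('a) / 2)) * (R powr (2 * p + 2) * r i powr (- 2 * p - 2))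
      \<le> nonlocal_const TYPE('a) alpha lam * r i powr (real DIM('a) + 2 - alpha - 2 * p * lam) *
        (((16 * pi) powr (- real DIM('a) / 2)) powr sigma * r i powr (- 2 * p * sigma))"
begin

section \<open>Smoothness of the sum of pulses\<close>

definition v :: "nat \<Rightarrow> 'a \<times> real \<Rightarrow> real" where
  "v i = pulse (r i) (s i) (r i powr (real DIM('a) - 2 * p))"

definition u :: "'a \<times> real \<Rightarrow> real" where
  "u z = (\<Sum>i. v i z)"

lemma lam_gt1: "1 < lam"
proof -
  have "1 < (real DIM('a) + 2) / real DIM('a)" by (simp add: field_simps)
  then show ?thesis using lam by linarith
qed

text \<open>This follows from 2 p lambda < n + 2 <= n lambda. It makes the amplitudes r_i^(n - 2p)
  summable.\<close>

lemma two_p_less: "2 * p < real DIM('a)"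
proof -
  have "2 * p * lam < real DIM('a) * lam"
    using p lam by (simp add: field_simps)
  then show ?thesis using lam_gt1 by simp
qed

lemma v_nonneg: "0 \<le> v i z"
  by (simp add: v_def pulse_nonneg)

lemma smooth_on_v: "smooth_on UNIV (v i)"
  unfolding v_def by (rule smooth_on_pulse[OF r_pos])

text \<open>Since the switching times tend to 0, all but finitely many pulses are fully on after t0
  / 2. There they are multiples of translates of one kernel, evaluated on a fixed compact set, so
  their derivatives are bounded by a multiple of the summable amplitudes.\<close>

lemma iter_deriv_v_bound:
  assumes "0 < t0" "set l \<subseteq> Basis"
  shows "\<exists>M. summable M \<and> (\<forall>\<^sub>F i in sequentially. \<forall>z\<in>ball 0 X \<times> {t0<..<1}. \<bar>iter_deriv l (v i) z\<bar> \<le> M i)"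
proof -
  let ?K = "\<lambda>z :: 'a \<times> real. heat_kernel (fst z) (snd z)" and ?P = "{z :: 'a \<times> real. snd z > 0}"
  let ?a = "\<lambda>i. r i powr (real DIM('a) - 2 * p)"
  let ?W = "ball 0 X \<times> {t0<..<1} :: ('a \<times> real) set"
  have sm: "smooth_on ?P ?K"
    unfolding smooth_on_def
  proof
    show "Ck_on k ?P ?K" for k
      using Ck_on_heat_kernel[OF open_snd_gt[of 0], of 0 k] by simp
  qed
  \<comment> \<open>After the translation the time is t - s_i + r_i^2. It is at least t0 / 2 for
    large i and, as -s_i <= r_i^2 <= 1, at most 3.\<close>
  define C where "C = (cball 0 X \<times> {t0 / 2..3} :: ('a \<times> real) set)"
  have "compact C" unfolding C_def by (intro compact_Times) auto
  moreover have "continuous_on C (iter_deriv l ?K)"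
    using smooth_onD(1)[OF smooth_on_iter_deriv[OF sm assms(2)]]
    by (rule continuous_on_subset) (use assms in \<open>auto simp: C_def\<close>)
  ultimately have "bounded (iter_deriv l ?K ` C)"
    using compact_continuous_image compact_imp_bounded by blast
  then obtain B where B: "\<And>z. z \<in> C \<Longrightarrow> \<bar>iter_deriv l ?K z\<bar> \<le> B"
    by (auto simp: bounded_iff)
  have "(\<lambda>i. s i + (r i)\<^sup>2) \<longlonglongrightarrow> 0 + 0\<^sup>2"
    by (intro tendsto_intros s_lim r_tendsto)
  then have "\<forall>\<^sub>F i in sequentially. s i + (r i)\<^sup>2 < t0 / 2"
    using assms(1) by (intro order_tendstoD(2)[of _ 0]) auto
  then have "\<forall>\<^sub>F i in sequentially. \<forall>z\<in>?W. \<bar>iter_deriv l (v i) z\<bar> \<le> ?a i * B"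
  proof eventually_elim
    case (elim i)
    have r1: "(r i)\<^sup>2 \<le> 1" "0 \<le> (r i)\<^sup>2" using r_le[of i] r_pos[of i] by (auto intro!: power_le_one)
    show ?case
    proof
      fix z assume z: "z \<in> ?W"
      define c where "c = (0 :: 'a, (r i)\<^sup>2 - s i)"
      have zc: "z + c \<in> C"
      proof -
        have "norm (fst z) < X" "t0 < snd z" "snd z < 1" using z by auto
        moreover from this have "t0 / 2 \<le> snd z + ((r i)\<^sup>2 - s i)" "snd z + ((r i)\<^sup>2 - s i) \<le> 3"
          using elim s_ge[of i] r1 assms(1) by linarith+
        ultimately show ?thesis by (cases z) (simp add: C_def c_def)
      qed
      have "iter_deriv l (v i) z = iter_deriv l (\<lambda>y. ?a i * ?K (y + c)) z"
      proof (rule iter_deriv_cong[OF _ _ z])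
        show "v i y = ?a i * ?K (y + c)" if "y \<in> ?W" for y
          using that elim assms(1) pulse_fully_on[OF r_pos, of "s i" i "snd y" "?a i" "fst y"] r1
          by (cases y) (auto simp: v_def c_def algebra_simps)
      qed (auto intro!: open_Times)
      also have "\<dots> = ?a i * iter_deriv l ?K (z + c)"
      proof (rule iter_deriv_shift[OF open_snd_gt sm assms(2)])
        show "z + c \<in> ?P" using zc assms(1) unfolding C_def mem_Collect_eq mem_Times_iff atLeastAtMost_iff by linarith
      qed
      finally show "\<bar>iter_deriv l (v i) z\<bar> \<le> ?a i * B"
        using B[OF zc] by (simp add: abs_mult mult_left_mono)
    qed
  qed
  moreover have "summable (\<lambda>i. ?a i * B)"
    using two_p_less by (intro summable_mult2 summable_r_powr) simp
  ultimately show ?thesis by blast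
qed

text \<open>Cylinders bounded in space and away from t = 0 are open and convex, as termwise
  differentiation needs, and the majorants hold uniformly on each.\<close>

lemma
  assumes "0 < t0"
  shows smooth_on_u_local: "smooth_on (ball 0 X \<times> {t0<..<1}) u"
    and sums_iter_deriv_u: "\<And>l z. set l \<subseteq> Basis \<Longrightarrow> z \<in> ball 0 X \<times> {t0<..<1} \<Longrightarrow>
      (\<lambda>i. iter_deriv l (v i) z) sums iter_deriv l u z"
proof -
  have 1: "open (ball 0 X \<times> {t0<..<1} :: ('a \<times> real) set)" "convex (ball 0 X \<times> {t0<..<1} :: ('a \<times> real) set)"
    by (auto intro!: open_Times convex_Times)
  have 2: "smooth_on (ball 0 X \<times> {t0<..<1}) (v i)" for i
    using smooth_on_v[of i] Ck_on_subset unfolding smooth_on_def by blast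
  show "smooth_on (ball 0 X \<times> {t0<..<1}) u"
    using smooth_on_suminf[OF 1 2 iter_deriv_v_bound[OF assms]] by (simp add: u_def[abs_def])
  show "\<And>l z. set l \<subseteq> Basis \<Longrightarrow> z \<in> ball 0 X \<times> {t0<..<1} \<Longrightarrow>
      (\<lambda>i. iter_deriv l (v i) z) sums iter_deriv l u z"
    using sums_iter_deriv[OF 1 2 iter_deriv_v_bound[OF assms]] by (simp add: u_def[abs_def])
qed

lemma sums_iter_deriv_u':
  assumes "set l \<subseteq> Basis" "0 < t" "t < 1"
  shows "(\<lambda>i. iter_deriv l (v i) (x, t)) sums iter_deriv l u (x, t)"
proof (rule sums_iter_deriv_u[where X = "norm x + 1" and ?t0.0 = "t / 2"])
  show "0 < t / 2" "set l \<subseteq> Basis" using assms by auto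
  show "(x, t) \<in> ball 0 (norm x + 1) \<times> {t / 2<..<1}" using assms by simp
qed

lemma smooth_on_u: "smooth_on (UNIV \<times> {0<..<1}) u"
  unfolding smooth_on_def
proof
  fix k
  let ?T = "{ball 0 X \<times> {t0<..<1} :: ('a \<times> real) set | X t0. 0 < t0}"
  have "Ck_on k (\<Union>?T) u"
    using smooth_on_u_local unfolding smooth_on_def by (intro Ck_on_Union) (auto intro!: open_Times)
  moreover have "UNIV \<times> {0<..<1} \<subseteq> \<Union>?T"
  proof
    fix z :: "'a \<times> real" assume "z \<in> UNIV \<times> {0<..<1}"
    then have "z \<in> ball 0 (norm (fst z) + 1) \<times> {snd z / 2<..<1}" "0 < snd z / 2" by auto
    then show "z \<in> \<Union>?T" by blast
  qed
  ultimately show "Ck_on k (UNIV \<times> {0<..<1}) u" by (rule Ck_on_subset)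
qed

lemma summable_v: "0 < t \<Longrightarrow> t < 1 \<Longrightarrow> summable (\<lambda>i. v i (x, t))"
  using sums_summable[OF sums_iter_deriv_u'[of "[]" t x]] by simp

lemma v_le_u: "0 < t \<Longrightarrow> t < 1 \<Longrightarrow> v i (x, t) \<le> u (x, t)"
  unfolding u_def using sum_le_suminf[OF summable_v, of t "{i}" x] v_nonneg by simp

text \<open>Pulse 0 belongs to the initial data, so at every positive time it is already fully on
  and positive everywhere.\<close>

lemma u_pos: "0 < t \<Longrightarrow> t < 1 \<Longrightarrow> 0 < u (x, t)"
proof -
  assume t: "0 < t" "t < 1"
  have "t - s 0 + (r 0)\<^sup>2 > 0" using t s0 zero_le_power2[of "r 0"] by linarith
  then have "0 < v 0 (x, t)"
    using t pulse_fully_on[OF r_pos, of "s 0" 0 t _ x] r0 heat_kernel_pos[of "t - s 0 + (r 0)\<^sup>2" x]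
    by (simp add: v_def s0)
  then show ?thesis using v_le_u[OF t, of 0 x] by linarith
qed

section \<open>The differential inequality\<close>

definition source :: "nat \<Rightarrow> 'a \<times> real \<Rightarrow> real" where
  "source i z = time_deriv (v i) z - space_laplacian (v i) z"

lemma source_eq: "source i (x, t) = r i powr (real DIM('a) - 2 * p) *
    smooth_step' ((t - s i) / (r i)\<^sup>2) / (r i)\<^sup>2 * heat_kernel x (t - s i + (r i)\<^sup>2)"
  unfolding source_def v_def by (subst heat_operator_pulse[OF r_pos]) simp

lemma source_nonneg: "0 \<le> source i z"
  by (cases z) (simp add: source_eq smooth_step'_bounds heat_kernel_nonneg)

lemma source_eq_0:
  assumes "t \<le> s i \<or> s i + (r i)\<^sup>2 \<le> t"
  shows "source i (x, t) = 0"
proof -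
  have "(r i)\<^sup>2 > 0" using r_pos[of i] by simp
  then have "(t - s i) / (r i)\<^sup>2 \<le> 0 \<or> 1 \<le> (t - s i) / (r i)\<^sup>2"
    using assms by (auto simp: divide_nonpos_pos le_divide_eq)
  then show ?thesis
    using smooth_step'_eq_0_left smooth_step'_eq_0_right by (auto simp: source_eq)
qed

lemma source_sums:
  assumes "0 < t" "t < 1"
  shows "(\<lambda>i. source i (x, t)) sums (time_deriv u (x, t) - space_laplacian u (x, t))"
proof -
  have "(\<lambda>i. time_deriv (v i) (x, t)) sums time_deriv u (x, t)"
    using sums_iter_deriv_u'[of "[(0, 1)]" t x] assms by (simp add: time_deriv_def Basis_prod_def)
  moreover have "(\<lambda>i. space_laplacian (v i) (x, t)) sums space_laplacian u (x, t)"
    unfolding space_laplacian_def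
  proof (rule sums_sum)
    fix b :: 'a assume "b \<in> Basis"
    then show "(\<lambda>i. frechet_derivative (\<lambda>q. frechet_derivative (v i) (at q) (b, 0)) (at (x, t)) (b, 0)) sums
        frechet_derivative (\<lambda>q. frechet_derivative u (at q) (b, 0)) (at (x, t)) (b, 0)"
      using sums_iter_deriv_u'[of "[(b, 0), (b, 0)]" t x] assms by (simp add: Basis_prod_def)
  qed
  ultimately show ?thesis
    unfolding source_def by (rule sums_diff)
qed

definition nonlocal :: "'a \<Rightarrow> real \<Rightarrow> ennreal" where
  "nonlocal x t = (\<integral>\<^sup>+ q. ennreal (indicator (UNIV \<times> {0<..<1}) q *
                 heat_kernel (x - fst q) (t - snd q) powr (alpha / real DIM('a)) *
                 u q powr lam) \<partial>lborel)"

text \<open>The active window of pulse k + 1 lies inside [s_k + 2 r_k^2, s_k + 3 r_k^2]. There the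
  predecessor alone bounds both the integral and \<open>u\<close> from below; \<open>gain\<close>
  compares constants and powers, and \<open>R_square\<close> the Gaussians.\<close>

lemma source_le_active:
  assumes "0 < t" "t < 1" and sS: "s (Suc k) = s k + 2 * (r k)\<^sup>2"
    and t: "s (Suc k) \<le> t" "t \<le> s (Suc k) + (r (Suc k))\<^sup>2"
  shows "ennreal (2 ^ (k + 2) * source (Suc k) (x, t)) \<le> nonlocal x t * ennreal (u (x, t) powr sigma)"
proof -
  define \<rho> where "\<rho> = r k"
  define X where "X = (norm x)\<^sup>2 / \<rho>\<^sup>2"
  define C1 where "C1 = 4 * (exp 1)\<^sup>2 * (4 * pi) powr (- real DIM('a) / 2)"
  define C2 where "C2 = nonlocal_const TYPE('a) alpha lam"
  define C3 where "C3 = ((16 * pi) powr (- real DIM('a) / 2)) powr sigma"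
  define P where "P = \<rho> powr (real DIM('a) + 2 - alpha - 2 * p * lam)"
  define Q where "Q = \<rho> powr (- 2 * p * sigma)"
  have \<rho>: "0 < \<rho>" "\<rho>\<^sup>2 > 0" using r_pos[of k] by (auto simp: \<rho>_def)
  have X0: "X \<ge> 0" by (simp add: X_def)
  have rS: "r (Suc k) = \<rho> / R" by (simp add: r_Suc \<rho>_def)
  have t3: "s k + 2 * \<rho>\<^sup>2 \<le> t" "t \<le> s k + 3 * \<rho>\<^sup>2"
    using t sS r_Suc_square_le[of k] zero_le_power2[of "r (Suc k)"] unfolding \<rho>_def by linarith+
  have "source (Suc k) (x, t) \<le> C1 * r (Suc k) powr (- 2 * p - 2) * exp (- (norm x)\<^sup>2 / (8 * (r (Suc k))\<^sup>2))"
    unfolding source_eq C1_def using t by (intro pulse_source_le r_pos) auto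
  also have "r (Suc k) powr (- 2 * p - 2) = R powr (2 * p + 2) * \<rho> powr (- 2 * p - 2)"
  proof -
    have "R powr (- 2 * p - 2) = 1 / R powr (2 * p + 2)"
      using powr_minus_divide[of R "2 * p + 2"] by simp
    then show ?thesis
      unfolding rS using \<rho> R2 by (simp add: powr_divide)
  qed
  finally have "source (Suc k) (x, t) \<le> C1 * (R powr (2 * p + 2) * \<rho> powr (- 2 * p - 2)) *
      exp (- (norm x)\<^sup>2 / (8 * (r (Suc k))\<^sup>2))" .
  \<comment> \<open>The source decays like exp(-(R^2 / 8) X), whereas the lower bounds for the
    integral and for the power of \<open>u\<close> decay only like exp(-(lambda / 4) X) and
    exp(-(sigma / 12) X).\<close>
  moreover have "exp (- (norm x)\<^sup>2 / (8 * (r (Suc k))\<^sup>2)) \<le> exp (- (lam / 4) * X) * exp (- (sigma / 12) * X)"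
  proof -
    have "(norm x)\<^sup>2 / (8 * (r (Suc k))\<^sup>2) = R\<^sup>2 / 8 * X"
      using \<rho> R2 by (simp add: rS X_def power_divide field_simps)
    moreover have "(lam / 4 + sigma / 12) * X \<le> R\<^sup>2 / 8 * X"
      using R_square sigma X0 by (intro mult_right_mono) auto
    ultimately show ?thesis by (simp add: algebra_simps flip: exp_add)
  qed
  moreover have "0 \<le> C1 * (R powr (2 * p + 2) * \<rho> powr (- 2 * p - 2))"
    by (simp add: C1_def)
  ultimately have src: "source (Suc k) (x, t) \<le> C1 * (R powr (2 * p + 2) * \<rho> powr (- 2 * p - 2)) *
      (exp (- (lam / 4) * X) * exp (- (sigma / 12) * X))"
    using mult_left_mono order_trans by blast
  have "2 ^ (k + 2) * source (Suc k) (x, t) \<le> 2 ^ (k + 2) * (C1 * (R powr (2 * p + 2) * \<rho> powr (- 2 * p - 2)) *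
      (exp (- (lam / 4) * X) * exp (- (sigma / 12) * X)))"
    using src by (intro mult_left_mono) auto
  also have "\<dots> = 2 ^ (k + 2) * C1 * (R powr (2 * p + 2) * \<rho> powr (- 2 * p - 2)) *
      (exp (- (lam / 4) * X) * exp (- (sigma / 12) * X))"
    by (simp only: mult.assoc)
  also have "\<dots> \<le> (C2 * P * (C3 * Q)) * (exp (- (lam / 4) * X) * exp (- (sigma / 12) * X))"
    using gain[of k] unfolding C1_def C2_def C3_def P_def Q_def \<rho>_def by (intro mult_right_mono) auto
  also have "\<dots> = (C2 * P * exp (- (lam / 4) * X)) * (C3 * Q * exp (- (sigma / 12) * X))"
    by (simp only: ac_simps)
  finally have main: "2 ^ (k + 2) * source (Suc k) (x, t)
      \<le> (C2 * P * exp (- (lam / 4) * X)) * (C3 * Q * exp (- (sigma / 12) * X))" .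
  have "ennreal (C2 * P * exp (- lam * (norm x)\<^sup>2 / (4 * \<rho>\<^sup>2))) \<le> nonlocal x t"
    unfolding nonlocal_def C2_def P_def
  proof (rule nonlocal_term_ge)
    show "pulse \<rho> (s k) (\<rho> powr (real DIM('a) - 2 * p)) (y, \<tau>) \<le> u (y, \<tau>)" if "0 < \<tau>" "\<tau> < 1" for y \<tau>
      using v_le_u[OF that, of k y] by (simp add: v_def \<rho>_def)
    show "0 \<le> s k + \<rho>\<^sup>2" "s k + 2 * \<rho>\<^sup>2 \<le> 1"
      using s_ge[of k] s_le[of k] \<rho>(2) unfolding \<rho>_def by linarith+
  qed (use \<rho> alpha lam_gt1 t3 in auto)
  then have nl: "ennreal (C2 * P * exp (- (lam / 4) * X)) \<le> nonlocal x t"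
    by (simp add: X_def)
  \<comment> \<open>The predecessor has kernel time between 3 and 4 times
    \<open>\<rho>\<^sup>2\<close>, whence 4 * 3 in the Gaussian and 16 pi in the prefactor.\<close>
  have "(16 * pi) powr (- real DIM('a) / 2) * \<rho> powr (- 2 * p) * exp (- (norm x)\<^sup>2 / (4 * 3 * \<rho>\<^sup>2)) \<le> u (x, t)"
  proof -
    have "(4 * pi * 4) powr (- real DIM('a) / 2) * \<rho> powr (- 2 * p) * exp (- (norm x)\<^sup>2 / (4 * 3 * \<rho>\<^sup>2))
        \<le> pulse \<rho> (s k) (\<rho> powr (real DIM('a) - 2 * p)) (x, t)"
      using t3 \<rho> by (intro pulse_ge_scaled) auto
    then show ?thesis using v_le_u[OF assms(1,2), of k x] by (simp add: v_def \<rho>_def)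
  qed
  then have "((16 * pi) powr (- real DIM('a) / 2) * \<rho> powr (- 2 * p) * exp (- (norm x)\<^sup>2 / (4 * 3 * \<rho>\<^sup>2))) powr sigma
      \<le> u (x, t) powr sigma"
    using sigma by (intro powr_mono2) auto
  moreover have "((16 * pi) powr (- real DIM('a) / 2) * \<rho> powr (- 2 * p) * exp (- (norm x)\<^sup>2 / (4 * 3 * \<rho>\<^sup>2))) powr sigma
      = C3 * Q * exp (- (sigma / 12) * X)"
  proof -
    have "exp (- (norm x)\<^sup>2 / (4 * 3 * \<rho>\<^sup>2)) powr sigma = exp (- (sigma / 12) * X)"
      by (simp add: powr_def X_def)
    then show ?thesis by (simp add: C3_def Q_def powr_mult powr_powr)
  qed
  ultimately have us: "C3 * Q * exp (- (sigma / 12) * X) \<le> u (x, t) powr sigma" by simp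
  have "0 \<le> C3 * Q * exp (- (sigma / 12) * X)" by (simp add: C3_def Q_def)
  moreover have "0 \<le> C2 * P * exp (- (lam / 4) * X)"
    using nonlocal_const_pos[where 'a = 'a, of alpha lam] by (simp add: C2_def P_def)
  ultimately have "ennreal ((C2 * P * exp (- (lam / 4) * X)) * (C3 * Q * exp (- (sigma / 12) * X)))
      = ennreal (C2 * P * exp (- (lam / 4) * X)) * ennreal (C3 * Q * exp (- (sigma / 12) * X))"
    by (rule ennreal_mult[rotated])
  also have "\<dots> \<le> nonlocal x t * ennreal (u (x, t) powr sigma)"
    by (intro mult_mono nl ennreal_leI us) auto
  finally show ?thesis
    using ennreal_leI[OF main] by (rule order_trans[rotated])
qed

lemma source_le:
  assumes "0 < t" "t < 1"
  shows "ennreal (source i (x, t)) \<le> ennreal ((1 / 2) ^ Suc i) * (nonlocal x t * ennreal (u (x, t) powr sigma))"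
proof (cases "t \<le> s i \<or> s i + (r i)\<^sup>2 \<le> t")
  case True
  then show ?thesis by (simp add: source_eq_0)
next
  case False
  \<comment> \<open>A restart has s_i + r_i^2 = 0 < t, so its source has already vanished. An active
    pulse therefore has a predecessor in its chain.\<close>
  then have "s i \<noteq> - (r i)\<^sup>2" using assms by auto
  then obtain k where k: "i = Suc k" "s (Suc k) = s k + 2 * (r k)\<^sup>2"
    using s0 s_Suc by (cases i) auto
  have "ennreal (source i (x, t)) = ennreal ((1 / 2) ^ Suc i) * ennreal (2 ^ (k + 2) * source i (x, t))"
    using source_nonneg[of i "(x, t)"] by (simp add: k(1) power_one_over field_simps flip: ennreal_mult)
  also have "\<dots> \<le> ennreal ((1 / 2) ^ Suc i) * (nonlocal x t * ennreal (u (x, t) powr sigma))"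
    using source_le_active[OF assms k(2)] False by (intro mult_left_mono) (auto simp: k(1))
  finally show ?thesis .
qed

lemma heat_operator_u_nonneg:
  assumes "0 < t" "t < 1"
  shows "0 \<le> time_deriv u (x, t) - space_laplacian u (x, t)"
  using sums_le[OF _ sums_zero source_sums[OF assms]] source_nonneg by blast

lemma heat_operator_u_le:
  assumes "0 < t" "t < 1"
  shows "ennreal (time_deriv u (x, t) - space_laplacian u (x, t))
    \<le> nonlocal x t * ennreal (u (x, t) powr sigma)"
proof -
  have "ennreal (time_deriv u (x, t) - space_laplacian u (x, t)) = (\<Sum>i. ennreal (source i (x, t)))"
    using suminf_ennreal_eq[OF source_nonneg source_sums[OF assms]] by simp
  also have "\<dots> \<le> (\<Sum>i. ennreal ((1 / 2) ^ Suc i) * (nonlocal x t * ennreal (u (x, t) powr sigma)))"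
    by (intro suminf_le source_le assms) auto
  also have "\<dots> = (\<Sum>i. ennreal ((1 / 2) ^ Suc i)) * (nonlocal x t * ennreal (u (x, t) powr sigma))"
    by (rule ennreal_suminf_multc)
  also have "(\<Sum>i. ennreal ((1 / 2) ^ Suc i)) = ennreal 1"
    by (rule suminf_ennreal_eq[OF _ power_half_series]) simp
  finally show ?thesis by (simp only: ennreal_1 mult_1)
qed

section \<open>Size at the switching times, and integrability\<close>

lemma u_at_peak:
  "(12 * pi) powr (- real DIM('a) / 2) * r i powr (- 2 * p) \<le> u (0, s i + 2 * (r i)\<^sup>2)"
proof -
  have "(r i)\<^sup>2 > 0" using r_pos[of i] by simp
  then have t: "0 < s i + 2 * (r i)\<^sup>2" "s i + 2 * (r i)\<^sup>2 < 1"
    using s_ge[of i] s_le[of i] by linarith+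
  \<comment> \<open>At this time the kernel time of pulse \<open>i\<close> is exactly 3
    r_i^2.\<close>
  have "(4 * pi * 3) powr (- real DIM('a) / 2) * r i powr (- 2 * p) * exp (- (norm (0 :: 'a))\<^sup>2 / (4 * 3 * (r i)\<^sup>2))
      \<le> v i (0, s i + 2 * (r i)\<^sup>2)"
    unfolding v_def by (intro pulse_ge_scaled r_pos) auto
  then show ?thesis using v_le_u[OF t, of i 0] by simp
qed

text \<open>The integral of the power of pulse i is at most of order r_i^kappa. Half of this
  exponent is spent on dividing by the weights \<open>w i\<close> of \<open>suminf_powr_le\<close>;
  the other half keeps the weighted integrals summable.\<close>

lemma nn_integral_u_powr_finite:
  "(\<integral>\<^sup>+ z. ennreal (indicator (UNIV \<times> {0<..<1}) z * u z powr lam) \<partial>lborel) < \<infinity>"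
proof -
  let ?n = "real DIM('a)" and ?\<Omega> = "UNIV \<times> {0<..<1} :: ('a \<times> real) set"
  \<comment> \<open>At most a quarter of the gap n + 2 - 2 p lambda, so that the loss 2 eta leaves
    \<open>\<kappa>\<close> positive.\<close>
  define \<eta> where "\<eta> = min 1 ((?n + 2 - 2 * p * lam) / 4)"
  define \<kappa> where "\<kappa> = ?n + 2 - 2 * p * lam - 2 * \<eta>"
  have \<eta>: "0 < \<eta>" "\<eta> \<le> 1" using p by (auto simp: \<eta>_def)
  have "2 * \<eta> < A" if "\<eta> \<le> A / 4" "0 < A" for A using that by linarith
  from this[of "?n + 2 - 2 * p * lam"] have \<kappa>: "0 < \<kappa>"
    using p min.cobounded2[of 1 "(?n + 2 - 2 * p * lam) / 4"] unfolding \<kappa>_def \<eta>_def by simp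
  define w where "w i = r i powr (\<kappa> / (2 * lam))" for i
  define W where "W = (\<Sum>i. w i)"
  have w: "0 < w i" for i using r_pos[of i] by (simp add: w_def)
  have sw: "summable w" unfolding w_def using \<kappa> lam_gt1 by (intro summable_r_powr) auto
  have meas: "v i \<in> borel_measurable borel" for i
    using smooth_onD(1)[OF smooth_on_v] by (rule borel_measurable_continuous_onI)
  have meas': "(\<lambda>z. ennreal (indicator ?\<Omega> z * (v i z / w i) powr lam)) \<in> borel_measurable lborel" for i
  proof -
    have [measurable]: "?\<Omega> \<in> sets borel" by (auto intro!: borel_open open_Times)
    note meas[of i, measurable]
    show ?thesis by measurable
  qed
  have piece: "(\<integral>\<^sup>+ z. ennreal (indicator ?\<Omega> z * (v i z / w i) powr lam) \<partial>lborel)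
      \<le> ennreal (4 / \<eta> * r i powr (\<kappa> / 2))" for i
  proof -
    have "(\<integral>\<^sup>+ z. ennreal (indicator ?\<Omega> z * (v i z / w i) powr lam) \<partial>lborel)
       = (\<integral>\<^sup>+ z. ennreal (r i powr (- \<kappa> / 2)) * ennreal (indicator ?\<Omega> z * v i z powr lam) \<partial>lborel)"
    proof (rule nn_integral_cong)
      fix z
      have "w i powr lam = r i powr (\<kappa> / 2)"
        using lam_gt1 by (simp add: w_def powr_powr)
      then have "(v i z / w i) powr lam = r i powr (- \<kappa> / 2) * v i z powr lam"
        using v_nonneg w[of i] powr_minus_divide[of "r i" "\<kappa> / 2"] by (simp add: powr_divide less_imp_le)
      then show "ennreal (indicator ?\<Omega> z * (v i z / w i) powr lam)
          = ennreal (r i powr (- \<kappa> / 2)) * ennreal (indicator ?\<Omega> z * v i z powr lam)"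
        by (simp add: ac_simps flip: ennreal_mult)
    qed
    also have "\<dots> = ennreal (r i powr (- \<kappa> / 2)) * (\<integral>\<^sup>+ z. ennreal (indicator ?\<Omega> z * v i z powr lam) \<partial>lborel)"
    proof (rule nn_integral_cmult)
      have [measurable]: "?\<Omega> \<in> sets borel" by (auto intro!: borel_open open_Times)
      note meas[of i, measurable]
      show "(\<lambda>z. ennreal (indicator ?\<Omega> z * v i z powr lam)) \<in> borel_measurable lborel" by measurable
    qed
    also have "\<dots> \<le> ennreal (r i powr (- \<kappa> / 2)) *
        ennreal (4 / \<eta> * (r i powr (?n - 2 * p)) powr lam * r i powr (2 - 2 * \<eta> - ?n * (lam - 1)))"
    proof (rule mult_left_mono)
      have "?n + 2 \<le> ?n * lam" using lam by (simp add: field_simps)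
      then have "1 \<le> ?n * (lam - 1) / 2" by (simp add: algebra_simps)
      moreover have "r i \<le> 1" using r_le[of i] by simp
      ultimately show "(\<integral>\<^sup>+ z. ennreal (indicator ?\<Omega> z * v i z powr lam) \<partial>lborel)
        \<le> ennreal (4 / \<eta> * (r i powr (?n - 2 * p)) powr lam * r i powr (2 - 2 * \<eta> - ?n * (lam - 1)))"
        unfolding v_def using r_pos s_ge \<eta> by (intro nn_integral_pulse_powr_le) auto
    qed simp
    also have "\<dots> = ennreal (4 / \<eta> * r i powr (\<kappa> / 2))"
    proof -
      \<comment> \<open>The exponent (n - 2p) lambda + 2 - 2 eta - n (lambda - 1) simplifies to
        \<open>\<kappa>\<close>.\<close>
      have "- \<kappa> / 2 + ((?n - 2 * p) * lam + (2 - 2 * \<eta> - ?n * (lam - 1))) = \<kappa> / 2"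
        by (simp add: \<kappa>_def field_simps)
      then have "r i powr (- \<kappa> / 2) * ((r i powr (?n - 2 * p)) powr lam * r i powr (2 - 2 * \<eta> - ?n * (lam - 1)))
          = r i powr (\<kappa> / 2)"
        by (simp only: powr_powr powr_add[symmetric])
      then have "r i powr (- \<kappa> / 2) * (4 / \<eta> * (r i powr (?n - 2 * p)) powr lam * r i powr (2 - 2 * \<eta> - ?n * (lam - 1)))
          = 4 / \<eta> * r i powr (\<kappa> / 2)"
        by (simp only: mult.assoc mult.left_commute[of _ "4 / \<eta>"])
      then show ?thesis using \<eta> by (simp flip: ennreal_mult)
    qed
    finally show ?thesis .
  qed
  have "(\<integral>\<^sup>+ z. ennreal (indicator ?\<Omega> z * u z powr lam) \<partial>lborel)
     \<le> (\<integral>\<^sup>+ z. ennreal (W powr lam) * (\<Sum>i. ennreal (indicator ?\<Omega> z * (v i z / w i) powr lam)) \<partial>lborel)"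
  proof (rule nn_integral_mono)
    fix z :: "'a \<times> real"
    show "ennreal (indicator ?\<Omega> z * u z powr lam)
       \<le> ennreal (W powr lam) * (\<Sum>i. ennreal (indicator ?\<Omega> z * (v i z / w i) powr lam))"
    proof (cases "z \<in> ?\<Omega>")
      case True
      then have "summable (\<lambda>i. v i z)" using summable_v[of "snd z" "fst z"] by auto
      moreover have "indicator ?\<Omega> z = (1 :: real)" using True by simp
      ultimately show ?thesis
        unfolding u_def W_def using lam_gt1 by (simp only: mult_1) (intro suminf_powr_le v_nonneg w sw, auto)
    qed simp
  qed
  also have "\<dots> = ennreal (W powr lam) * (\<Sum>i. \<integral>\<^sup>+ z. ennreal (indicator ?\<Omega> z * (v i z / w i) powr lam) \<partial>lborel)"
    using meas' by (subst nn_integral_cmult) (auto intro!: borel_measurable_suminf_order simp: nn_integral_suminf)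
  also have "\<dots> \<le> ennreal (W powr lam) * (\<Sum>i. ennreal (4 / \<eta> * r i powr (\<kappa> / 2)))"
    by (intro mult_left_mono suminf_le piece) auto
  also have "(\<Sum>i. ennreal (4 / \<eta> * r i powr (\<kappa> / 2))) = ennreal (\<Sum>i. 4 / \<eta> * r i powr (\<kappa> / 2))"
    using \<eta> \<kappa> by (intro suminf_ennreal2 summable_mult summable_r_powr) auto
  also have "ennreal (W powr lam) * ennreal (\<Sum>i. 4 / \<eta> * r i powr (\<kappa> / 2)) < \<infinity>"
    by (simp add: ennreal_mult_less_top)
  finally show ?thesis .
qed

lemma integrable_u_powr: "(\<lambda>z. \<bar>u z\<bar> powr lam) integrable_on (UNIV \<times> {0<..<1})"
proof -
  let ?\<Omega> = "UNIV \<times> {0<..<1} :: ('a \<times> real) set"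
  have [measurable]: "?\<Omega> \<in> sets borel" by (auto intro!: borel_open open_Times)
  have [measurable]: "v i \<in> borel_measurable borel" for i
    using smooth_onD(1)[OF smooth_on_v] by (rule borel_measurable_continuous_onI)
  have [measurable]: "u \<in> borel_measurable borel"
    unfolding u_def[abs_def] by measurable
  have eq: "indicator ?\<Omega> z *\<^sub>R \<bar>u z\<bar> powr lam = indicator ?\<Omega> z * u z powr lam" for z
    using u_pos[of "snd z" "fst z"] by (auto split: split_indicator)
  have "integrable lborel (\<lambda>z. indicator ?\<Omega> z * u z powr lam)"
  proof (rule integrableI_nonneg)
    show "(\<lambda>z. indicator ?\<Omega> z * u z powr lam) \<in> borel_measurable lborel" by measurable
  qed (use nn_integral_u_powr_finite in auto)
  then have "set_integrable lborel ?\<Omega> (\<lambda>z. \<bar>u z\<bar> powr lam)"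
    unfolding set_integrable_def eq .
  then show ?thesis by (rule set_borel_integral_eq_integral(1))
qed

end

section \<open>Choice of exponents, radii and restart times\<close>

theorem theorem5p3:
  fixes alpha lam sigma :: real
    and \<phi> :: "real \<Rightarrow> real"
  assumes "0 < alpha" "alpha < real DIM('a::euclidean_space) + 2"
    and "lam \<ge> (real DIM('a) + 2) / real DIM('a)"
    and "sigma \<ge> 0"
    and "sigma > 1 + (2 - alpha) / (real DIM('a) + 2) * lam"
    and "continuous_on {0<..<1} \<phi>"
    and "\<forall>t\<in>{0<..<1}. \<phi> t > 0"
    and "filterlim \<phi> at_top (at_right 0)"
  shows "\<exists>u :: 'a \<times> real \<Rightarrow> real.
     (\<forall>x t. 0 < t \<and> t < 1 \<longrightarrow> u (x, t) > 0)
   \<and> smooth_on (UNIV \<times> {0<..<1}) u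
   \<and> (\<lambda>p. \<bar>u p\<bar> powr lam) integrable_on (UNIV \<times> {0<..<1})
   \<and> (\<forall>x t. 0 < t \<and> t < 1 \<longrightarrow>
        0 \<le> time_deriv u (x, t) - space_laplacian u (x, t)
      \<and> ennreal (time_deriv u (x, t) - space_laplacian u (x, t))
          \<le> (\<integral>\<^sup>+ q. ennreal (indicator (UNIV \<times> {0<..<1}) q *
                 heat_kernel (x - fst q) (t - snd q) powr (alpha / real DIM('a)) *
                 u q powr lam) \<partial>lborel)
            * ennreal (u (x, t) powr sigma))
   \<and> (\<lambda>t. u (0, t)) \<notin> O[at_right 0](\<phi>)"
proof -
  let ?n = "real DIM('a)"
  have n: "?n \<ge> 1" by (simp add: Suc_leI)
  have "1 < (?n + 2) / ?n" by (simp add: field_simps)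
  then have lam1: "1 < lam" using assms(3) by linarith
  define L where "L = lam + sigma - 1"
  \<comment> \<open>The supremum of the exponents p with 2 p lambda < n + 2.\<close>
  define p0 where "p0 = (?n + 2) / (2 * lam)"
  \<comment> \<open>The hypothesis on sigma, cleared of denominators, says that the other condition
    2 p L > n + 4 - alpha holds strictly at \<open>p0\<close>, which leaves room for a smaller
    p.\<close>
  have key: "?n + 4 - alpha < 2 * p0 * L"
  proof -
    have "(2 - alpha) * lam < (sigma - 1) * (?n + 2)"
      using assms(5) n by (simp add: field_simps)
    then have "(?n + 4 - alpha) * lam < (?n + 2) * L"
      by (simp add: L_def algebra_simps)
    then show ?thesis using lam1 by (simp add: p0_def field_simps)
  qed
  have p0: "0 < p0" using lam1 n by (simp add: p0_def)
  have "0 < 2 * p0 * L" using key assms(2) by linarith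
  then have L: "0 < L" using p0 by (simp add: zero_less_mult_iff)
  \<comment> \<open>The midpoint of the two bounds on p. The surplus \<open>gam\<close> is the
    exponent by which the right-hand side then beats the source.\<close>
  define p where "p = ((?n + 4 - alpha) / (2 * L) + p0) / 2"
  define gam where "gam = 2 * p * L - (?n + 4 - alpha)"
  have pL: "(?n + 4 - alpha) / (2 * L) < p0" using key L by (simp add: field_simps)
  moreover have "0 < (?n + 4 - alpha) / (2 * L)" using L assms(2) by simp
  moreover have "0 < (M + p0) / 2 \<and> (M + p0) / 2 < p0 \<and> M < (M + p0) / 2" if "M < p0" "0 < M" for M
    using that by simp
  ultimately have p: "0 < p" "p < p0" "(?n + 4 - alpha) / (2 * L) < p"
    unfolding p_def by blast+
  have gam: "0 < gam" using p(3) L by (simp add: gam_def field_simps)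
  have plam: "2 * p * lam < ?n + 2" using p(2) lam1 by (simp add: p0_def field_simps)
  \<comment> \<open>The three summands secure in turn R >= 2, \<open>R_square\<close> and R^gam >=
    2.\<close>
  define R where "R = 2 + 2 * (lam + sigma) + 2 powr (1 / gam)"
  have R: "2 \<le> R" "2 * (lam + sigma) \<le> R" "2 powr (1 / gam) \<le> R"
    using lam1 assms(4) by (auto simp: R_def)
  have R_square: "2 * (lam + sigma) \<le> R\<^sup>2"
  proof -
    have "1 * R \<le> R * R" using R(1) by (intro mult_right_mono) auto
    then show ?thesis using R(2) by (simp add: power2_eq_square)
  qed
  have R_gam: "2 \<le> R powr gam"
  proof -
    have "(2 powr (1 / gam)) powr gam \<le> R powr gam" using R gam by (intro powr_mono2) auto
    then show ?thesis using gam by (simp add: powr_powr)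
  qed
  define C1 where "C1 = 4 * (exp 1)\<^sup>2 * (4 * pi) powr (- ?n / 2)"
  define C2 where "C2 = nonlocal_const TYPE('a) alpha lam"
  define C3 where "C3 = ((16 * pi) powr (- ?n / 2)) powr sigma"
  have C: "0 < C1" "0 < C2" "0 < C3"
    by (auto simp: C1_def C2_def C3_def nonlocal_const_pos)
  \<comment> \<open>\<open>N\<close> shifts the sequence of radii, so that the surplus absorbs all
    constants from the first pulse on.\<close>
  obtain N where N: "4 * C1 * R powr (2 * p + 2) / (C2 * C3) < 2 ^ N"
    using real_arch_pow[of 2] by auto
  define r where "r i = (1 / R) ^ (i + Suc N)" for i :: nat
  have r_pos: "0 < r i" for i using R by (simp add: r_def)
  \<comment> \<open>Pulse i reaches height of order r_i^(-2p), but the restart test compares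
    \<open>\<phi>\<close> with r_i^(-p) only. The spare factor r_i^(-p) tends to infinity and later
    defeats every constant in the O-estimate.\<close>
  define s where "s = rec_nat (- (r 0)\<^sup>2)
    (\<lambda>i y. if \<phi> (y + 2 * (r i)\<^sup>2) \<le> r i powr (- p) then - (r (Suc i))\<^sup>2 else y + 2 * (r i)\<^sup>2)"
  have s_rec: "s (Suc i) = (if \<phi> (s i + 2 * (r i)\<^sup>2) \<le> r i powr (- p) then - (r (Suc i))\<^sup>2 else s i + 2 * (r i)\<^sup>2)" for i
    by (simp add: s_def)
  interpret restart_scales R r s
  proof
    have "(1 / R) ^ Suc N \<le> (1 / R) ^ 1" using R by (intro power_decreasing) auto
    also have "\<dots> \<le> 1 / 2" using R by (simp add: field_simps)
    finally show "r 0 \<le> 1 / 2" by (simp add: r_def)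
    show "s 0 = - (r 0)\<^sup>2" by (simp add: s_def)
    show "s (Suc i) = - (r (Suc i))\<^sup>2 \<or> s (Suc i) = s i + 2 * (r i)\<^sup>2" for i
      by (simp add: s_rec)
  qed (use R r_pos in \<open>auto simp: r_def\<close>)
  define T where "T i = s i + 2 * (r i)\<^sup>2" for i
  have T: "0 < T i" "T i \<le> 3 / 4" for i
    using s_ge[of i] s_le[of i] zero_less_power[OF r_pos[of i], of 2] unfolding T_def by linarith+
  have large: "\<forall>\<^sub>F i in sequentially. B < r i powr (- p)" for B
  proof -
    have "filterlim (\<lambda>i. r i powr (- p)) at_top sequentially"
    proof (rule filterlim_compose[of "\<lambda>y. y powr (- p)" at_top "at_right 0"])
      show "LIM y at_right 0. y powr (- p) :> at_top"
        using p(1) by real_asymp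
      show "filterlim r (at_right 0) sequentially"
        using r_tendsto r_pos by (intro tendsto_imp_filterlim_at_right) auto
    qed
    then show ?thesis by (simp add: filterlim_at_top_dense)
  qed
  \<comment> \<open>A chain without further restarts has nondecreasing times \<open>T i\<close> in
    the compact subset [T m, 3/4] of (0, 1). There \<open>\<phi>\<close> is bounded, whereas
    r_i^(-p) is not.\<close>
  have restart: "\<exists>i\<ge>m. \<phi> (T i) \<le> r i powr (- p)" for m
  proof (rule ccontr)
    assume "\<not> (\<exists>i\<ge>m. \<phi> (T i) \<le> r i powr (- p))"
    then have no: "r i powr (- p) < \<phi> (T i)" if "i \<ge> m" for i using that by force
    have "T m \<le> T i" if "i \<ge> m" for i
      using that
    proof (induction i rule: dec_induct)
      case (step i)
      have "s (Suc i) = T i" using no[OF step(1)] s_rec[of i] by (simp add: T_def)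
      then have "T i \<le> T (Suc i)" by (simp add: T_def[of "Suc i"])
      then show ?case using step(3) by linarith
    qed simp
    then have sub: "T i \<in> {T m..3 / 4}" if "i \<ge> m" for i using that T by auto
    have "compact (\<phi> ` {T m..3 / 4})"
      using T(1)[of m] by (intro compact_continuous_image continuous_on_subset[OF assms(6)]) auto
    then have "bdd_above (\<phi> ` {T m..3 / 4})"
      by (intro bounded_imp_bdd_above compact_imp_bounded)
    then obtain B where B: "\<And>t. t \<in> {T m..3 / 4} \<Longrightarrow> \<phi> t \<le> B"
      unfolding bdd_above_def by blast
    obtain i where "i \<ge> m" "B < r i powr (- p)"
      using eventually_happens'[OF sequentially_bot eventually_conj[OF large[of B] eventually_ge_at_top[of m]]] by blast
    then show False using no[of i] B[OF sub[of i]] by simp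
  qed
  have s_lim: "s \<longlonglongrightarrow> 0"
  proof (rule s_tendsto)
    fix m
    obtain i where "i \<ge> m" "\<phi> (T i) \<le> r i powr (- p)" using restart by blast
    then show "\<exists>i\<ge>m. s i = - (r i)\<^sup>2"
      using s_rec[of i] by (intro exI[of _ "Suc i"]) (simp add: T_def)
  qed
  interpret pulse_chain R r s "TYPE('a)" alpha lam sigma p
  proof
    fix i
    \<comment> \<open>The surplus r_i^(-gam) is at least 2^(i + N + 1): the part 2^i pays for the
      growing weights, and 2^N for the constants.\<close>
    have "((1 / R) ^ k) powr (- gam) = (R powr gam) ^ k" for k
    proof -
      have "(1 / R) ^ k = R powr (- real k)"
        using R by (simp add: powr_minus_divide powr_realpow power_one_over)
      then show ?thesis
        using R by (simp add: powr_powr mult.commute flip: powr_realpow)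
    qed
    then have "r i powr (- gam) = (R powr gam) ^ (i + Suc N)"
      unfolding r_def .
    moreover have "2 ^ (i + Suc N) \<le> (R powr gam) ^ (i + Suc N)"
      using R_gam by (intro power_mono) auto
    ultimately have rg: "2 ^ (i + Suc N) \<le> r i powr (- gam)" by simp
    have "4 * C1 * R powr (2 * p + 2) \<le> 2 ^ N * (C2 * C3)"
      using N C by (simp add: field_simps)
    then have "2 ^ i * (4 * C1 * R powr (2 * p + 2)) \<le> 2 ^ i * (2 ^ N * (C2 * C3))"
      by (intro mult_left_mono) auto
    then have "2 ^ (i + 2) * C1 * R powr (2 * p + 2) \<le> 2 ^ (i + N) * (C2 * C3)"
      by (simp add: power_add)
    also have "\<dots> \<le> r i powr (- gam) * (C2 * C3)"
    proof (rule mult_right_mono)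
      have "(2::real) ^ (i + N) \<le> 2 ^ (i + Suc N)" by (intro power_increasing) auto
      then show "2 ^ (i + N) \<le> r i powr (- gam)" using rg by linarith
    qed (use C in auto)
    finally have "2 ^ (i + 2) * C1 * R powr (2 * p + 2) * r i powr (- 2 * p - 2)
        \<le> r i powr (- gam) * (C2 * C3) * r i powr (- 2 * p - 2)"
      by (intro mult_right_mono) auto
    also have "\<dots> = C2 * C3 * (r i powr (- gam) * r i powr (- 2 * p - 2))"
      by (simp only: ac_simps)
    also have "r i powr (- gam) * r i powr (- 2 * p - 2)
        = r i powr (?n + 2 - alpha - 2 * p * lam) * r i powr (- 2 * p * sigma)"
    proof -
      \<comment> \<open>The surplus exponent was defined so that it turns the power of r in the
        source into the one on the right-hand side.\<close>
      have "- gam + (- 2 * p - 2) = ?n + 2 - alpha - 2 * p * lam + (- 2 * p * sigma)"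
        by (simp add: gam_def L_def algebra_simps)
      then show ?thesis by (simp only: powr_add[symmetric])
    qed
    finally show "2 ^ (i + 2) * (4 * (exp 1)\<^sup>2 * (4 * pi) powr (- ?n / 2)) * (R powr (2 * p + 2) * r i powr (- 2 * p - 2))
      \<le> nonlocal_const TYPE('a) alpha lam * r i powr (?n + 2 - alpha - 2 * p * lam) *
        (((16 * pi) powr (- ?n / 2)) powr sigma * r i powr (- 2 * p * sigma))"
      unfolding C1_def[symmetric] C2_def[symmetric] C3_def[symmetric] by (simp only: ac_simps)
  qed (use assms(1,3,4) p plam R_square s_lim in auto)
  have not_O: "(\<lambda>t. u (0, t)) \<notin> O[at_right 0](\<phi>)"
  proof
    assume "(\<lambda>t. u (0, t)) \<in> O[at_right 0](\<phi>)"
    then obtain c where c: "c > 0" "\<forall>\<^sub>F t in at_right 0. norm (u (0, t)) \<le> c * norm (\<phi> t)"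
      by (rule landau_o.bigE)
    define D where "D = (12 * pi) powr (- ?n / 2)"
    have D: "D > 0" by (simp add: D_def)
    have "T \<longlonglongrightarrow> 0 + 2 * 0\<^sup>2"
      unfolding T_def[abs_def] by (intro tendsto_intros s_lim r_tendsto)
    then have "filterlim T (at_right 0) sequentially"
      using T(1) by (intro tendsto_imp_filterlim_at_right) auto
    then have "\<forall>\<^sub>F i in sequentially. norm (u (0, T i)) \<le> c * norm (\<phi> (T i))"
      using c(2) by (rule eventually_compose_filterlim[rotated])
    with large[of "c / D"] have "\<forall>\<^sub>F i in sequentially. c / D < r i powr (- p) \<and> norm (u (0, T i)) \<le> c * norm (\<phi> (T i))"
      by (rule eventually_conj)
    then obtain m where m: "\<And>i. i \<ge> m \<Longrightarrow> c / D < r i powr (- p) \<and> norm (u (0, T i)) \<le> c * norm (\<phi> (T i))"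
      by (auto simp: eventually_sequentially)
    \<comment> \<open>At a restart index beyond \<open>m\<close> both estimates combine: u >= D
      r_i^(-2p) >= D r_i^(-p) phi(T i), which exceeds c phi(T i).\<close>
    obtain i where i: "i \<ge> m" "\<phi> (T i) \<le> r i powr (- p)" using restart by blast
    have phi: "0 < \<phi> (T i)" using assms(7) T[of i] by auto
    have "c * \<phi> (T i) < D * r i powr (- p) * \<phi> (T i)"
      using m[OF i(1)] D phi by (intro mult_strict_right_mono) (auto simp: field_simps)
    also have "\<dots> \<le> D * r i powr (- p) * r i powr (- p)"
      using i(2) D by (intro mult_left_mono) auto
    also have "\<dots> = D * r i powr (- 2 * p)"
      by (simp add: mult.assoc flip: powr_add)
    also have "\<dots> \<le> u (0, T i)"
      using u_at_peak[of i] by (simp add: D_def T_def)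
    finally have "c * \<phi> (T i) < u (0, T i)" .
    moreover have "u (0, T i) \<le> c * \<phi> (T i)" using m[OF i(1)] phi by auto
    ultimately show False by simp
  qed
  show ?thesis
    using u_pos smooth_on_u integrable_u_powr heat_operator_u_nonneg
      heat_operator_u_le[unfolded nonlocal_def] not_O
    by (intro exI[of _ u]) blast
qed

end
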